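(* Let $X$ be a ball Banach function space on $\mathbb{R}$, $p\in[1,\infty)$, $q\in[1,p]$, and $\gamma\in(-\infty,-1)$. Assume that $X^{1/p}$ is a ball Banach function space and that the Hardy--Littlewood maximal operator $\mathcal{M}$ is bounded on $(X^{1/p})'$ with operator norm $\|\mathcal{M}\|_{(X^{1/p})'\to(X^{1/p})'}$. Then there exists a positive constant $C$, depending only on $p,q,\gamma$ and $\|\mathcal{M}\|_{(X^{1/p})'\to(X^{1/p})'}$, such that for every $f\in C^1(\mathbb{R})$ with $f'\in C_{\mathrm c}(\mathbb{R})$, $$\sup_{\lambda>0}\lambda\left\|\left[\int_{\mathbb{R}}\mathbf{1}_{E_{\lambda,\gamma/q}[f]}(\cdot,y)|\cdot-y|^{\gamma-1}dy\right]^{1/q}\right\|_X\le C\|f'\|_X,$$ and $C$ is continuous with respect to $\|\mathcal{M}\|_{(X^{1/p})'\to(X^{1/p})'}$ and increases as it increases.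
   Context: A quasi-Banach space $X$ of measurable functions on $\mathbb{R}$ with quasi-norm defined on all measurable functions is a ball quasi-Banach function space if: $\|f\|_X=0$ implies $f=0$ a.e.; $|g|\le|f|$ a.e. implies $\|g\|_X\le\|f\|_X$; $0\le f_m\uparrow f$ a.e. implies $\|f_m\|_X\uparrow\|f\|_X$; $\mathbf{1}_B\in X$ for every bounded interval $B$. It is a ball Banach function space if moreover the triangle inequality holds and for every bounded interval $B$ there is $C_B$ with $\int_B|f|\le C_B\|f\|_X$. For $t>0$, $X^t:=\{f:|f|^t\in X\}$, $\|f\|_{X^t}:=\|\,|f|^t\|_X^{1/t}$. Associate space: $Y':=\{f:\|f\|_{Y'}:=\sup_{\|g\|_Y=1}\|fg\|_{L^1}<\infty\}$. $\mathcal{M}$ is the Hardy--Littlewood maximal operator; bounded on $Y$ with least constant $\|\mathcal{M}\|_{Y\to Y}$. $E_{\lambda,\beta}[f]:=\{(x,y)\in\mathbb{R}^2:x\ne y,\ |f(x)-f(y)|/|x-y|^{1+\beta}>\lambda\}$. *)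

theory Defs
  imports "HOL-Analysis.Analysis"
begin

text \<open>A (quasi-)normed function space on the real line is modelled by its quasi-norm
  functional N, defined on all non-negative functions (only measurable ones matter);
  the norm of a real-valued f is N applied to the modulus of f.
  Functions outside the space have norm infinity.\<close>

type_synonym fnorm = "(real \<Rightarrow> ennreal) \<Rightarrow> ennreal"

definition enn_pow :: "ennreal \<Rightarrow> real \<Rightarrow> ennreal" where
  "enn_pow x t = (if x = \<infinity> then \<infinity> else ennreal (enn2real x powr t))"

definition ball_qbfs :: "fnorm \<Rightarrow> bool" where
  "ball_qbfs N \<longleftrightarrow>
     (\<exists>K::real. K \<ge> 1 \<and> (\<forall>a b. a \<in> borel_measurable lebesgue \<longrightarrow> b \<in> borel_measurable lebesgue \<longrightarrow>
         N (\<lambda>x. a x + b x) \<le> ennreal K * (N a + N b))) \<and>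
     (\<forall>a (c::real). a \<in> borel_measurable lebesgue \<longrightarrow> c \<ge> 0 \<longrightarrow> N (\<lambda>x. ennreal c * a x) = ennreal c * N a) \<and>
     (\<forall>a. a \<in> borel_measurable lebesgue \<longrightarrow> N a = 0 \<longrightarrow> (AE x in lebesgue. a x = 0)) \<and>
     (\<forall>a b. a \<in> borel_measurable lebesgue \<longrightarrow> b \<in> borel_measurable lebesgue \<longrightarrow>
         (AE x in lebesgue. b x \<le> a x) \<longrightarrow> N b \<le> N a) \<and>
     (\<forall>A a. (\<forall>n. A n \<in> borel_measurable lebesgue) \<longrightarrow> a \<in> borel_measurable lebesgue \<longrightarrow>
         (AE x in lebesgue. incseq (\<lambda>n. A n x) \<and> (\<lambda>n. A n x) \<longlonglongrightarrow> a x) \<longrightarrow>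
         (\<lambda>n. N (A n)) \<longlonglongrightarrow> N a) \<and>
     (\<forall>s t. N (indicator {s..t}) < \<infinity>)"

definition ball_bfs :: "fnorm \<Rightarrow> bool" where
  "ball_bfs N \<longleftrightarrow> ball_qbfs N \<and>
     (\<forall>a b. a \<in> borel_measurable lebesgue \<longrightarrow> b \<in> borel_measurable lebesgue \<longrightarrow>
         N (\<lambda>x. a x + b x) \<le> N a + N b) \<and>
     (\<forall>s t. \<exists>C::real. C \<ge> 0 \<and> (\<forall>a. a \<in> borel_measurable lebesgue \<longrightarrow> N a < \<infinity> \<longrightarrow>
         (\<integral>\<^sup>+ x. a x * indicator {s..t} x \<partial>lebesgue) \<le> ennreal C * N a))"

definition convexify :: "fnorm \<Rightarrow> real \<Rightarrow> fnorm" where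
  "convexify N t = (\<lambda>a. enn_pow (N (\<lambda>x. enn_pow (a x) t)) (1 / t))"

definition assoc_space :: "fnorm \<Rightarrow> fnorm" where
  "assoc_space N = (\<lambda>a. SUP b \<in> {b. b \<in> borel_measurable lebesgue \<and> N b = 1}.
                        \<integral>\<^sup>+ x. a x * b x \<partial>lebesgue)"

definition HL_max :: "(real \<Rightarrow> ennreal) \<Rightarrow> real \<Rightarrow> ennreal" where
  "HL_max a x = (SUP st \<in> {(s, t). s < x \<and> x < t}.
       ennreal (1 / (snd st - fst st)) * (\<integral>\<^sup>+ y. a y * indicator {fst st..snd st} y \<partial>lebesgue))"

definition max_bounded_const :: "fnorm \<Rightarrow> real \<Rightarrow> bool" where
  "max_bounded_const N C \<longleftrightarrow> C \<ge> 0 \<and>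
     (\<forall>a. a \<in> borel_measurable lebesgue \<longrightarrow> N a < \<infinity> \<longrightarrow> N (HL_max a) \<le> ennreal C * N a)"

definition max_bounded :: "fnorm \<Rightarrow> bool" where
  "max_bounded N \<longleftrightarrow> (\<exists>C. max_bounded_const N C)"

definition max_opnorm :: "fnorm \<Rightarrow> real" where
  "max_opnorm N = Inf {C. max_bounded_const N C}"

definition E_set :: "real \<Rightarrow> real \<Rightarrow> (real \<Rightarrow> real) \<Rightarrow> (real \<times> real) set" where
  "E_set lam \<beta> f = {(x, y). x \<noteq> y \<and> \<bar>f x - f y\<bar> / \<bar>x - y\<bar> powr (1 + \<beta>) > lam}"

end

theory Submission
  imports Defs
begin

text \<open>
  Let \<open>Y = X^{1/p}\<close>, \<open>F = |f'| powr p\<close> and \<open>d = - \<gamma> p / q > 1\<close>. For fixed \<open>\<lambda>\<close> let \<open>\<rho> x\<close> be the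
  smallest radius for which the mass of \<open>F\<close> on the ball \<open>B(x, \<rho> x)\<close> reaches
  \<open>\<lambda> powr p * \<rho> x powr (1 - d)\<close>. By Jensen's inequality every \<open>y\<close> with \<open>(x, y)\<close> in the level set is
  at distance at least \<open>\<rho> x\<close> from \<open>x\<close>, so the inner integral is at most
  \<open>2 / (- \<gamma>) * \<rho> x powr \<gamma>\<close>, and it suffices to bound \<open>\<lambda> powr p * \<rho> powr (- d)\<close> in \<open>Y\<close>.
  As \<open>d > 1\<close>, \<open>\<rho>\<close> is 1-Lipschitz. Minimising \<open>z \<mapsto> \<rho> z + |x - z| / 2\<close> yields a ball on which \<open>\<rho>\<close> is
  bounded below by half its radius, and testing on this ball gives
  \<open>\<lambda> powr p * \<rho> x powr (- d) \<le> C \<integral> F u / \<rho> u * max 1 (|x - u| / \<rho> u) powr (- d) du\<close>.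
  Integrated against \<open>h\<close>, the right-hand side is at most \<open>C \<integral> F * \<M> h\<close>, because \<open>d > 1\<close> makes the kernel
  an integrable radial bump of width \<open>\<rho> u\<close>. The boundedness of \<open>\<M>\<close> on \<open>Y'\<close> and \<open>Y'' = Y\<close>
  (Lorentz--Luxemburg, via projection in \<open>L\<^sup>2\<close> onto the unit ball of \<open>Y\<close>) conclude.
\<close>

subsection \<open>Ball Banach function spaces and duality\<close>

lemma
  assumes "ball_qbfs N"
  shows ball_qbfs_scale: "a \<in> borel_measurable lebesgue \<Longrightarrow> c \<ge> 0 \<Longrightarrow>
      N (\<lambda>x. ennreal c * a x) = ennreal c * N a"
    and ball_qbfs_eq_0: "a \<in> borel_measurable lebesgue \<Longrightarrow> N a = 0 \<Longrightarrow> AE x in lebesgue. a x = 0"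
    and ball_qbfs_mono: "a \<in> borel_measurable lebesgue \<Longrightarrow> b \<in> borel_measurable lebesgue \<Longrightarrow>
      AE x in lebesgue. b x \<le> a x \<Longrightarrow> N b \<le> N a"
    and ball_qbfs_tendsto: "(\<And>n. A n \<in> borel_measurable lebesgue) \<Longrightarrow> a \<in> borel_measurable lebesgue \<Longrightarrow>
      AE x in lebesgue. incseq (\<lambda>n. A n x) \<and> (\<lambda>n. A n x) \<longlonglongrightarrow> a x \<Longrightarrow> (\<lambda>n. N (A n)) \<longlonglongrightarrow> N a"
    and ball_qbfs_indicator: "N (indicator {s..t}) < \<infinity>"
  using assms unfolding ball_qbfs_def by (blast, blast, blast, blast, blast)

lemma
  assumes "ball_bfs N"
  shows ball_bfs_qbfs: "ball_qbfs N"
    and ball_bfs_triangle: "a \<in> borel_measurable lebesgue \<Longrightarrow> b \<in> borel_measurable lebesgue \<Longrightarrow>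
      N (\<lambda>x. a x + b x) \<le> N a + N b"
  using assms unfolding ball_bfs_def by blast+

lemma indicator_Icc_measurable [measurable]:
  "(indicator {l..u::real} :: real \<Rightarrow> 'a::{zero_neq_one,second_countable_topology}) \<in> borel_measurable lebesgue"
  by (rule borel_measurable_indicator) simp

lemma ball_qbfs_zero:
  assumes "ball_qbfs N"
  shows "N (\<lambda>x. 0) = 0"
  using ball_qbfs_scale[OF assms, of "\<lambda>_. 0" 0] by simp

text \<open>Convexity of the unit ball of \<open>N\<close>, from homogeneity and the triangle
  inequality. It supplies the competitors (midpoints and points of short segments) in the projection
  argument.\<close>

lemma ball_bfs_convex_combination:
  fixes b c :: "real \<Rightarrow> real"
  assumes N: "ball_bfs N" and [measurable]: "b \<in> borel_measurable lebesgue" "c \<in> borel_measurable lebesgue"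
    and b: "\<And>x. 0 \<le> b x" "N (\<lambda>x. ennreal (b x)) \<le> 1"
    and c: "\<And>x. 0 \<le> c x" "N (\<lambda>x. ennreal (c x)) \<le> 1"
    and t: "0 \<le> t" "t \<le> 1"
  shows "N (\<lambda>x. ennreal ((1 - t) * b x + t * c x)) \<le> 1"
proof -
  have "N (\<lambda>x. ennreal ((1 - t) * b x + t * c x)) =
      N (\<lambda>x. ennreal (1 - t) * ennreal (b x) + ennreal t * ennreal (c x))"
    using t b c by (simp add: ennreal_mult ennreal_plus)
  also have "\<dots> \<le> N (\<lambda>x. ennreal (1 - t) * ennreal (b x)) + N (\<lambda>x. ennreal t * ennreal (c x))"
    by (rule ball_bfs_triangle[OF N]) measurable
  also have "\<dots> = ennreal (1 - t) * N (\<lambda>x. ennreal (b x)) + ennreal t * N (\<lambda>x. ennreal (c x))"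
    using t by (simp add: ball_qbfs_scale[OF ball_bfs_qbfs[OF N]])
  also have "\<dots> \<le> ennreal (1 - t) * 1 + ennreal t * 1"
    by (intro add_mono mult_left_mono b c) auto
  also have "\<dots> = 1"
    using t by (simp flip: ennreal_plus)
  finally show ?thesis .
qed

section \<open>Projection in L^2 onto the unit ball, and separation\<close>

lemma integrable_bounded_interval:
  fixes f :: "real \<Rightarrow> real"
  assumes [measurable]: "f \<in> borel_measurable lebesgue"
    and "\<And>x. \<bar>f x\<bar> \<le> B * indicator {l..u} x"
  shows "integrable lebesgue f"
proof (rule Bochner_Integration.integrable_bound)
  have "integrable lebesgue (indicator {l..u} :: real \<Rightarrow> real)"
    by (simp add: integrable_indicator_iff emeasure_lborel_Icc_eq)
  then show "integrable lebesgue (\<lambda>x. B * indicator {l..u} x)" by simp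
  show "AE x in lebesgue. norm (f x) \<le> norm (B * indicator {l..u} x)"
    using assms(2) by (intro AE_I2) (metis abs_ge_self order_trans real_norm_def)
qed simp

text \<open>The Fatou property for sequences that need not be monotone: the tail infima increase to
  the limit a.e. and lie below the terms. With \<open>C = 1\<close> it shows that the unit ball is
  closed under a.e. limits.\<close>

lemma ball_qbfs_lim_le:
  fixes b :: "nat \<Rightarrow> real \<Rightarrow> real"
  assumes N: "ball_qbfs N" and [measurable]: "\<And>k. b k \<in> borel_measurable lebesgue"
      "c \<in> borel_measurable lebesgue"
    and lim: "AE x in lebesgue. (\<lambda>k. b k x) \<longlonglongrightarrow> c x"
    and le: "\<And>k. N (\<lambda>x. ennreal (b k x)) \<le> C"
  shows "N (\<lambda>x. ennreal (c x)) \<le> C"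
proof -
  define A where "A n = (\<lambda>x. INF k\<in>{n..}. ennreal (b k x))" for n :: nat
  have [measurable]: "A n \<in> borel_measurable lebesgue" for n
    unfolding A_def by measurable
  have "(\<lambda>n. N (A n)) \<longlonglongrightarrow> N (\<lambda>x. ennreal (c x))"
  proof (rule ball_qbfs_tendsto[OF N])
    show "AE x in lebesgue. incseq (\<lambda>n. A n x) \<and> (\<lambda>n. A n x) \<longlonglongrightarrow> ennreal (c x)"
      using lim
    proof eventually_elim
      case (elim x)
      have inc: "incseq (\<lambda>n. A n x)"
        unfolding A_def by (intro monoI INF_superset_mono) auto
      have "liminf (\<lambda>k. ennreal (b k x)) = ennreal (c x)"
        using elim by (intro lim_imp_Liminf tendsto_ennrealI) auto
      then have "(SUP n. A n x) = ennreal (c x)"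
        by (simp add: A_def liminf_SUP_INF)
      with inc LIMSEQ_SUP[OF inc] show ?case by simp
    qed
  qed measurable
  moreover have "N (A n) \<le> C" for n
  proof -
    have "N (A n) \<le> N (\<lambda>x. ennreal (b n x))"
      by (rule ball_qbfs_mono[OF N]) (auto simp: A_def intro!: INF_lower)
    with le show ?thesis using order_trans by blast
  qed
  ultimately show ?thesis
    by (intro LIMSEQ_le_const2) auto
qed

text \<open>Existence of a nearest point by the direct method. Restricting to
  \<open>0 \<le> b \<le> g\<close> makes all candidates bounded with support in
  \<open>{l..u}\<close>, so every integral is finite and dominated convergence applies.\<close>

lemma ball_bfs_projection:
  fixes g :: "real \<Rightarrow> real"
  assumes N: "ball_bfs N" and [measurable]: "g \<in> borel_measurable lebesgue"
    and g: "\<And>x. 0 \<le> g x" "\<And>x. g x \<le> B * indicator {l..u} x"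
  obtains b where "b \<in> borel_measurable lebesgue" "\<And>x. 0 \<le> b x" "\<And>x. b x \<le> g x"
    "N (\<lambda>x. ennreal (b x)) \<le> 1"
    "\<And>c. c \<in> borel_measurable lebesgue \<Longrightarrow> (\<And>x. 0 \<le> c x) \<Longrightarrow> (\<And>x. c x \<le> g x) \<Longrightarrow>
      N (\<lambda>x. ennreal (c x)) \<le> 1 \<Longrightarrow>
      (\<integral>x. (g x - b x)\<^sup>2 \<partial>lebesgue) \<le> (\<integral>x. (g x - c x)\<^sup>2 \<partial>lebesgue)"
proof -
  define K where "K = {b \<in> borel_measurable lebesgue. (\<forall>x. 0 \<le> b x \<and> b x \<le> g x) \<and>
      N (\<lambda>x. ennreal (b x)) \<le> 1}"
  define J where "J b = (\<integral>x. (g x - b x)\<^sup>2 \<partial>lebesgue)" for b :: "real \<Rightarrow> real"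
  define d where "d = (INF b\<in>K. J b)"
  have "(\<lambda>x. 0) \<in> K"
    using g ball_qbfs_zero[OF ball_bfs_qbfs[OF N]] by (simp add: K_def)
  then have K_ne: "K \<noteq> {}" by blast
  have J_nonneg: "0 \<le> J b" for b by (simp add: J_def)
  have bdd: "bdd_below (J ` K)" using J_nonneg by (auto intro!: bdd_belowI)
  have d_le: "d \<le> J b" if "b \<in> K" for b
    unfolding d_def by (rule cINF_lower[OF bdd that])
  have bound: "(v x)\<^sup>2 \<le> B\<^sup>2 * indicator {l..u} x" "\<bar>v x\<bar> \<le> B * indicator {l..u} x"
    if "\<bar>v x\<bar> \<le> g x" for v :: "real \<Rightarrow> real" and x
  proof -
    have *: "\<bar>v x\<bar> \<le> B * indicator {l..u} x" using that g(2) order_trans by blast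
    then have "\<bar>v x\<bar>^2 \<le> (B * indicator {l..u} x)\<^sup>2" by (rule power_mono) simp
    then show "(v x)\<^sup>2 \<le> B\<^sup>2 * indicator {l..u} x" "\<bar>v x\<bar> \<le> B * indicator {l..u} x"
      using * by (cases "x \<in> {l..u}"; simp)+
  qed
  have int2: "integrable lebesgue (\<lambda>x. (v x)\<^sup>2)"
    if [measurable]: "v \<in> borel_measurable lebesgue" and "\<And>x. \<bar>v x\<bar> \<le> g x" for v
    using bound(1) that(2) by (intro integrable_bounded_interval[where B="B\<^sup>2" and l=l and u=u]) auto
  \<comment> \<open>The rate \<open>(1/8)^k\<close> is fast enough to survive the factor
    \<open>2^k\<close> that is lost below in passing from L^2 to L^1 bounds.\<close>
  have "\<exists>b\<in>K. J b \<le> d + (1/8)^k" for k :: nat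
  proof -
    have "d < d + (1/8)^k" by simp
    then obtain b where "b \<in> K" "J b < d + (1/8)^k"
      unfolding d_def using cINF_less_iff[OF K_ne bdd] by blast
    then show ?thesis by force
  qed
  then obtain b where b: "\<And>k. b k \<in> K" "\<And>k. J (b k) \<le> d + (1/8)^k" by metis
  have [measurable]: "b k \<in> borel_measurable lebesgue" for k using b(1) by (simp add: K_def)
  have b0: "0 \<le> b k x" "b k x \<le> g x" for k x using b(1) by (simp_all add: K_def)
  have bN: "N (\<lambda>x. ennreal (b k x)) \<le> 1" for k using b(1) by (simp add: K_def)
  have b_diff: "\<bar>b i x - b j x\<bar> \<le> g x" "\<bar>g x - b i x\<bar> \<le> g x" for i j x
    using b0[of i x] b0[of j x] by auto
  \<comment> \<open>Parallelogram law: the midpoint \<open>m\<close> of two consecutive terms stays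
    in \<open>K\<close>, so \<open>J m \<ge> d\<close>, and near-minimality of both terms forces
    them together.\<close>
  have sq: "(\<integral>x. (b (Suc k) x - b k x)\<^sup>2 \<partial>lebesgue) \<le> 4 * (1/8)^k" for k
  proof -
    define m where "m = (\<lambda>x. (1 - 1/2) * b (Suc k) x + 1/2 * b k x)"
    have m0: "0 \<le> m x" "m x \<le> g x" for x
      using b0[of k x] b0[of "Suc k" x] by (auto simp: m_def)
    have "N (\<lambda>x. ennreal (m x)) \<le> 1"
      unfolding m_def by (rule ball_bfs_convex_combination[OF N]) (use b0 bN in auto)
    then have "m \<in> K" using m0 by (simp add: K_def) (simp add: m_def)
    have [measurable]: "m \<in> borel_measurable lebesgue" by (simp add: m_def)
    have "(\<integral>x. (b (Suc k) x - b k x)\<^sup>2 \<partial>lebesgue)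
        = (\<integral>x. 2 * (g x - b (Suc k) x)\<^sup>2 + 2 * (g x - b k x)\<^sup>2 - 4 * (g x - m x)\<^sup>2 \<partial>lebesgue)"
      by (rule Bochner_Integration.integral_cong) (auto simp: m_def power2_eq_square field_simps)
    also have "\<dots> = 2 * J (b (Suc k)) + 2 * J (b k) - 4 * J m"
    proof -
      have "integrable lebesgue (\<lambda>x. (g x - m x)\<^sup>2)"
        using m0 by (intro int2) (auto simp: abs_le_iff intro: order_trans)
      moreover have "integrable lebesgue (\<lambda>x. (g x - b i x)\<^sup>2)" for i
        using b_diff by (intro int2) auto
      ultimately show ?thesis by (simp add: J_def)
    qed
    also have "\<dots> \<le> 2 * (d + (1/8)^Suc k) + 2 * (d + (1/8)^k) - 4 * d"
      by (intro diff_mono add_mono mult_left_mono b(2) d_le \<open>m \<in> K\<close>) auto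
    also have "\<dots> \<le> 4 * (1/8)^k" by simp
    finally show ?thesis .
  qed
  define I where "I = indicat_real {l..u}"
  have [measurable]: "I \<in> borel_measurable lebesgue" by (simp add: I_def indicator_Icc_measurable)
  have I_int: "integrable lebesgue I"
    by (simp add: I_def integrable_indicator_iff emeasure_lborel_Icc_eq)
  have I_nonneg: "0 \<le> integral\<^sup>L lebesgue I" by (simp add: I_def)
  have l1: "(\<integral>x. \<bar>b (Suc k) x - b k x\<bar> \<partial>lebesgue) \<le> (1/2)^k * (integral\<^sup>L lebesgue I + 2)"
    and l1_int: "integrable lebesgue (\<lambda>x. \<bar>b (Suc k) x - b k x\<bar>)" for k
  proof -
    let ?v = "\<lambda>x. b (Suc k) x - b k x"
    have int_v: "integrable lebesgue ?v"
      using b_diff bound(2)[of ?v]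
      by (intro integrable_bounded_interval[where B=B and l=l and u=u]) auto
    have int_v2: "integrable lebesgue (\<lambda>x. (?v x)\<^sup>2)"
      using b_diff by (intro int2) auto
    from int_v show "integrable lebesgue (\<lambda>x. \<bar>?v x\<bar>)" by simp
    \<comment> \<open>Weighted AM-GM, from the square of \<open>2^k * \<bar>?v x\<bar> - 1\<close>
      being nonnegative. With this weight both terms have integrals summable in
      \<open>k\<close>.\<close>
    have pt: "\<bar>?v x\<bar> \<le> (1/2)^k * I x + 2^k/2 * (?v x)\<^sup>2" for x
    proof (cases "x \<in> {l..u}")
      case True
      have "0 \<le> (2^k * \<bar>?v x\<bar> - 1)\<^sup>2" by simp
      also have "\<dots> = 2^k * (2^k * (?v x)\<^sup>2) + 1 - 2 * 2^k * \<bar>?v x\<bar>"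
        by (simp add: power2_diff power_mult_distrib) (simp add: power2_eq_square)
      finally have "2 * 2^k * \<bar>?v x\<bar> \<le> 2^k * (2^k * (?v x)\<^sup>2) + 1" by simp
      then have "\<bar>?v x\<bar> \<le> (1/2)^k / 2 + 2^k/2 * (?v x)\<^sup>2"
        by (simp add: field_simps power_divide)
      also have "\<dots> \<le> (1/2)^k + 2^k/2 * (?v x)\<^sup>2" by simp
      finally show ?thesis using True by (simp add: I_def)
    next
      case False
      then have "g x = 0" using g[of x] by simp
      then show ?thesis using b_diff(1)[of "Suc k" x k] by (simp add: I_def False)
    qed
    have "(\<integral>x. \<bar>?v x\<bar> \<partial>lebesgue) \<le> (\<integral>x. (1/2)^k * I x + 2^k/2 * (?v x)\<^sup>2 \<partial>lebesgue)"
      by (rule integral_mono) (use int_v int_v2 I_int pt in auto)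
    also have "\<dots> = (1/2)^k * integral\<^sup>L lebesgue I + 2^k/2 * (\<integral>x. (?v x)\<^sup>2 \<partial>lebesgue)"
      using int_v2 I_int by simp
    also have "\<dots> \<le> (1/2)^k * integral\<^sup>L lebesgue I + 2^k/2 * (4 * (1/8)^k)"
      by (intro add_mono mult_left_mono sq) auto
    also have "2^k/2 * (4 * (1/8)^k) = 2 * (1/4::real)^k"
      by (simp flip: power_mult_distrib)
    also have "(1/2)^k * integral\<^sup>L lebesgue I + 2 * (1/4)^k \<le> (1/2)^k * integral\<^sup>L lebesgue I + 2 * (1/2)^k"
      by (intro add_mono mult_left_mono power_mono) auto
    also have "\<dots> = (1/2)^k * (integral\<^sup>L lebesgue I + 2)" by (simp add: algebra_simps)
    finally show "(\<integral>x. \<bar>?v x\<bar> \<partial>lebesgue) \<le> (1/2)^k * (integral\<^sup>L lebesgue I + 2)" .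
  qed
  \<comment> \<open>Summable L^1 norms of the increments make the telescoping series absolutely
    convergent at almost every point.\<close>
  have conv: "AE x in lebesgue. convergent (\<lambda>k. b k x)"
  proof -
    have "(\<integral>\<^sup>+x. (\<Sum>k. ennreal \<bar>b (Suc k) x - b k x\<bar>) \<partial>lebesgue)
        = (\<Sum>k. ennreal (\<integral>x. \<bar>b (Suc k) x - b k x\<bar> \<partial>lebesgue))"
      using l1_int by (subst nn_integral_suminf) (auto simp: nn_integral_eq_integral)
    also have "\<dots> \<le> (\<Sum>k. ennreal ((1/2)^k * (integral\<^sup>L lebesgue I + 2)))"
      by (intro suminf_le ennreal_leI l1) auto
    also have "\<dots> < \<infinity>"
      using I_nonneg by (subst suminf_ennreal2) (auto intro!: summable_mult2 summable_geometric)
    finally have "AE x in lebesgue. (\<Sum>k. ennreal \<bar>b (Suc k) x - b k x\<bar>) \<noteq> \<infinity>"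
      by (intro nn_integral_PInf_AE) auto
    then show ?thesis
    proof eventually_elim
      case (elim x)
      then have "summable (\<lambda>k. \<bar>b (Suc k) x - b k x\<bar>)"
        by (intro summable_suminf_not_top) auto
      then have "summable (\<lambda>k. b (Suc k) x - b k x)"
        by (rule summable_rabs_cancel)
      then have "convergent (\<lambda>k. b k x - b 0 x)"
        unfolding summable_iff_convergent sum_lessThan_telescope[of "\<lambda>k. b k x"] .
      from convergent_add[OF this convergent_const[of "b 0 x"]] show ?case by simp
    qed
  qed
  \<comment> \<open>The liminf is measurable and defined at every point; the cut at \<open>g\<close>
    makes \<open>c x \<le> g x\<close> immediate, also where the sequence does not converge.\<close>
  define c where "c x = min (enn2real (liminf (\<lambda>k. ennreal (b k x)))) (g x)" for x
  have [measurable]: "c \<in> borel_measurable lebesgue"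
    unfolding c_def by measurable
  have c_lim: "(\<lambda>k. b k x) \<longlonglongrightarrow> c x" if "convergent (\<lambda>k. b k x)" for x
  proof -
    obtain y where y: "(\<lambda>k. b k x) \<longlonglongrightarrow> y" using \<open>convergent _\<close> by (auto simp: convergent_def)
    then have "0 \<le> y" "y \<le> g x"
      using LIMSEQ_le_const[OF y] LIMSEQ_le_const2[OF y] b0 by blast+
    moreover have "liminf (\<lambda>k. ennreal (b k x)) = ennreal y"
      using y by (intro lim_imp_Liminf tendsto_ennrealI) auto
    ultimately show ?thesis using y by (simp add: c_def)
  qed
  have AE_lim: "AE x in lebesgue. (\<lambda>k. b k x) \<longlonglongrightarrow> c x"
    using conv by eventually_elim (rule c_lim)
  have c0: "0 \<le> c x \<and> c x \<le> g x" for x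
    using g(1) by (simp add: c_def)
  have cN: "N (\<lambda>x. ennreal (c x)) \<le> 1"
    by (rule ball_qbfs_lim_le[OF ball_bfs_qbfs[OF N] _ _ AE_lim bN]) measurable
  have "(\<lambda>k. J (b k)) \<longlonglongrightarrow> J c"
    unfolding J_def
  proof (rule integral_dominated_convergence)
    show "integrable lebesgue (\<lambda>x. (g x)\<^sup>2)"
      using g by (intro int2) auto
    show "AE x in lebesgue. (\<lambda>k. (g x - b k x)\<^sup>2) \<longlonglongrightarrow> (g x - c x)\<^sup>2"
      using AE_lim by eventually_elim (auto intro!: tendsto_intros)
    show "AE x in lebesgue. norm ((g x - b k x)\<^sup>2) \<le> (g x)\<^sup>2" for k
      using b_diff(2) g(1) by (intro AE_I2) (auto intro!: abs_le_square_iff[THEN iffD1])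
  qed measurable
  moreover have "(\<lambda>k. d + (1/8)^k) \<longlonglongrightarrow> d + 0"
    by (intro tendsto_intros LIMSEQ_power_zero) auto
  ultimately have "J c \<le> d"
    using b(2) by (intro LIMSEQ_le[of "\<lambda>k. J (b k)" _ "\<lambda>k. d + (1/8)^k"]) auto
  then show thesis
    using c0 cN d_le by (intro that[of c]) (auto simp: J_def K_def intro: order_trans)
qed


text \<open>A concrete Hahn-Banach separation: the residual \<open>\<phi> = g - b\<close> from the
  nearest point \<open>b\<close> is an outward normal to the unit ball, so on that ball the pairing
  with \<open>\<phi>\<close> is largest at \<open>b\<close>, while \<open>g\<close> lies strictly
  beyond. Dividing \<open>\<phi>\<close> by this largest value \<open>s\<close> gives
  \<open>h\<close>.\<close>

lemma ball_bfs_separation: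
  fixes g :: "real \<Rightarrow> real"
  assumes N: "ball_bfs N" and [measurable]: "g \<in> borel_measurable lebesgue"
    and g: "\<And>x. 0 \<le> g x" "\<And>x. g x \<le> B * indicator {l..u} x"
    and gN: "N (\<lambda>x. ennreal (g x)) > 1"
  obtains h :: "real \<Rightarrow> ennreal" where "h \<in> borel_measurable lebesgue" "assoc_space N h \<le> 1"
    "(\<integral>\<^sup>+x. ennreal (g x) * h x \<partial>lebesgue) > 1"
proof -
  note Q = ball_bfs_qbfs[OF N]
  obtain b where [measurable]: "b \<in> borel_measurable lebesgue"
    and b: "\<And>x. 0 \<le> b x" "\<And>x. b x \<le> g x" and bN: "N (\<lambda>x. ennreal (b x)) \<le> 1"
    and b_min: "\<And>c. c \<in> borel_measurable lebesgue \<Longrightarrow> (\<And>x. 0 \<le> c x) \<Longrightarrow> (\<And>x. c x \<le> g x) \<Longrightarrow>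
      N (\<lambda>x. ennreal (c x)) \<le> 1 \<Longrightarrow>
      (\<integral>x. (g x - b x)\<^sup>2 \<partial>lebesgue) \<le> (\<integral>x. (g x - c x)\<^sup>2 \<partial>lebesgue)"
    using ball_bfs_projection[OF N assms(2) g] by blast
  define I where "I = indicat_real {l..u}"
  have [measurable]: "I \<in> borel_measurable lebesgue" by (simp add: I_def indicator_Icc_measurable)
  define \<phi> where "\<phi> x = g x - b x" for x
  have [measurable]: "\<phi> \<in> borel_measurable lebesgue" unfolding \<phi>_def by measurable
  have \<phi>: "0 \<le> \<phi> x" "\<phi> x \<le> B * I x" for x
    using b[of x] g[of x] by (auto simp: \<phi>_def I_def)
  have outside: "g x = 0" "b x = 0" "\<phi> x = 0" if "x \<notin> {l..u}" for x
    using that g[of x] b[of x] by (auto simp: \<phi>_def)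
  have B: "B \<ge> 0" if "x \<in> {l..u}" for x
    using g[of x] that by simp
  have int: "integrable lebesgue (\<lambda>x. \<phi> x * v x)" "integrable lebesgue (\<lambda>x. I x * (v x)\<^sup>2)"
    if [measurable]: "v \<in> borel_measurable lebesgue" and v: "\<And>x. x \<in> {l..u} \<Longrightarrow> \<bar>v x\<bar> \<le> k" for v k
  proof -
    have "\<bar>\<phi> x * v x\<bar> \<le> B * k * indicator {l..u} x" for x
      using v[of x] \<phi>[of x] outside(3)[of x]
      by (cases "x \<in> {l..u}") (auto simp: abs_mult I_def intro!: mult_mono)
    then show "integrable lebesgue (\<lambda>x. \<phi> x * v x)"
      by (intro integrable_bounded_interval[where B="B * k" and l=l and u=u]) measurable
    have "\<bar>I x * (v x)\<^sup>2\<bar> \<le> k\<^sup>2 * indicator {l..u} x" for x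
      using v[of x] power_mono[of "\<bar>v x\<bar>" k 2] by (cases "x \<in> {l..u}") (auto simp: I_def)
    then show "integrable lebesgue (\<lambda>x. I x * (v x)\<^sup>2)"
      by (intro integrable_bounded_interval[where B="k\<^sup>2" and l=l and u=u]) measurable
  qed
  define s where "s = (\<integral>x. \<phi> x * b x \<partial>lebesgue)"
  have bB: "\<bar>b x\<bar> \<le> B" "\<bar>g x\<bar> \<le> B" "\<bar>\<phi> x\<bar> \<le> B" if "x \<in> {l..u}" for x
    using b[of x] g[of x] \<phi>[of x] that by (auto simp: I_def)
  \<comment> \<open>Variational inequality at the nearest point, first for bounded \<open>c\<close>
    so that all integrals are finite.\<close>
  have bdd_case: "(\<integral>x. \<phi> x * c x \<partial>lebesgue) \<le> s"
    if [measurable]: "c \<in> borel_measurable lebesgue" and c: "\<And>x. 0 \<le> c x" "\<And>x. c x \<le> k"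
      and cN: "N (\<lambda>x. ennreal (c x)) \<le> 1" for c k
  proof -
    define D where "D = (\<integral>x. \<phi> x * (c x - b x) \<partial>lebesgue)"
    \<comment> \<open>\<open>c\<close> need not vanish off \<open>{l..u}\<close>; the factor
      \<open>I\<close> makes the integrand integrable.\<close>
    define E where "E = (\<integral>x. I x * (c x - b x)\<^sup>2 \<partial>lebesgue)"
    have cb: "\<bar>c x - b x\<bar> \<le> k + B" if "x \<in> {l..u}" for x
      using c[of x] bB[of x] that by auto
    have int_cb: "integrable lebesgue (\<lambda>x. \<phi> x * (c x - b x))" "integrable lebesgue (\<lambda>x. I x * (c x - b x)\<^sup>2)"
      by (rule int[where k="k + B"], measurable, use cb in blast)+
    have int_\<phi>: "integrable lebesgue (\<lambda>x. (\<phi> x)\<^sup>2)"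
      unfolding power2_eq_square using bB by (intro int) auto
    have key: "2 * D \<le> t * E" if t: "0 < t" "t \<le> 1" for t
    proof -
      define w where "w x = (1 - t) * b x + t * c x" for x
      have [measurable]: "w \<in> borel_measurable lebesgue" unfolding w_def by measurable
      have w0: "0 \<le> w x" for x using b c t by (simp add: w_def)
      have wN: "N (\<lambda>x. ennreal (w x)) \<le> 1"
        unfolding w_def by (rule ball_bfs_convex_combination[OF N]) (use b c bN cN t in auto)
      \<comment> \<open>\<open>b\<close> is minimal only among functions below \<open>g\<close>.
        Cutting \<open>w\<close> at \<open>g\<close> keeps it in the unit ball and moves it no
        farther from \<open>g\<close>.\<close>
      have "N (\<lambda>x. ennreal (min (w x) (g x))) \<le> N (\<lambda>x. ennreal (w x))"
        by (rule ball_qbfs_mono[OF Q]) (auto intro!: ennreal_leI)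
      then have minN: "N (\<lambda>x. ennreal (min (w x) (g x))) \<le> 1" using wN by order
      have "(\<integral>x. (\<phi> x)\<^sup>2 \<partial>lebesgue) \<le> (\<integral>x. (g x - min (w x) (g x))\<^sup>2 \<partial>lebesgue)"
        unfolding \<phi>_def using w0 g minN by (intro b_min) auto
      also have "\<dots> \<le> (\<integral>x. (\<phi> x)\<^sup>2 - 2 * t * (\<phi> x * (c x - b x)) + t\<^sup>2 * (I x * (c x - b x)\<^sup>2) \<partial>lebesgue)"
      proof (rule integral_mono)
        show "integrable lebesgue (\<lambda>x. (g x - min (w x) (g x))\<^sup>2)"
        proof (rule integrable_bounded_interval)
          fix x
          have "\<bar>g x - min (w x) (g x)\<bar> \<le> B * indicator {l..u} x"
            using w0[of x] g[of x] by auto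
          from power_mono[OF this, of 2]
          show "\<bar>(g x - min (w x) (g x))\<^sup>2\<bar> \<le> B\<^sup>2 * indicator {l..u} x"
            by (auto simp: power_mult_distrib indicator_def split: if_splits)
        qed measurable
        show "integrable lebesgue (\<lambda>x. (\<phi> x)\<^sup>2 - 2 * t * (\<phi> x * (c x - b x)) + t\<^sup>2 * (I x * (c x - b x)\<^sup>2))"
          using int_cb int_\<phi> by simp
      next
        fix x
        show "(g x - min (w x) (g x))\<^sup>2 \<le> (\<phi> x)\<^sup>2 - 2 * t * (\<phi> x * (c x - b x)) + t\<^sup>2 * (I x * (c x - b x)\<^sup>2)"
        proof (cases "x \<in> {l..u}")
          case True
          have "(g x - min (w x) (g x))\<^sup>2 \<le> (g x - w x)\<^sup>2"
            by (rule abs_le_square_iff[THEN iffD1]) auto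
          also have "\<dots> = (\<phi> x)\<^sup>2 - 2 * t * (\<phi> x * (c x - b x)) + t\<^sup>2 * (c x - b x)\<^sup>2"
            by (simp add: w_def \<phi>_def power2_eq_square algebra_simps)
          finally show ?thesis using True by (simp add: I_def)
        next
          case False
          then show ?thesis using outside[OF False] w0[of x] by (simp add: I_def min_def)
        qed
      qed
      also have "\<dots> = (\<integral>x. (\<phi> x)\<^sup>2 \<partial>lebesgue) - 2 * t * D + t\<^sup>2 * E"
        using int_cb int_\<phi> by (simp add: D_def E_def)
      finally have "t * (2 * D) \<le> t * (t * E)" by (simp add: power2_eq_square algebra_simps)
      then show ?thesis using t by (simp add: mult_le_cancel_left)
    qed
    have "2 * D \<le> 0"
    proof (rule tendsto_lowerbound)
      show "((\<lambda>t. t * E) \<longlongrightarrow> 0) (at_right 0)" by (auto intro!: tendsto_eq_intros)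
      show "\<forall>\<^sub>F t in at_right 0. 2 * D \<le> t * E"
        using eventually_at_right_less eventually_at_right[of 0 1 "\<lambda>t. t \<le> 1"] key
        by (auto simp: eventually_at_right_field intro!: exI[of _ 1])
    qed auto
    moreover have "D = (\<integral>x. \<phi> x * c x \<partial>lebesgue) - s"
    proof -
      have "D = (\<integral>x. \<phi> x * c x - \<phi> x * b x \<partial>lebesgue)" by (simp add: D_def right_diff_distrib)
      also have "\<dots> = (\<integral>x. \<phi> x * c x \<partial>lebesgue) - s"
        unfolding s_def using c bB by (intro Bochner_Integration.integral_diff int[where k="max B k"])
          (auto simp: le_max_iff_disj)
      finally show ?thesis .
    qed
    ultimately show ?thesis by simp
  qed
  \<comment> \<open>Unbounded \<open>c\<close> are reached by truncation at height \<open>k\<close>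
    and monotone convergence.\<close>
  have gen: "(\<integral>\<^sup>+x. ennreal (\<phi> x) * c x \<partial>lebesgue) \<le> ennreal s"
    if [measurable]: "c \<in> borel_measurable lebesgue" and cN: "N c \<le> 1" for c
  proof -
    have "(\<integral>\<^sup>+x. ennreal (\<phi> x) * c x \<partial>lebesgue)
        = (\<integral>\<^sup>+x. (SUP k::nat. ennreal (\<phi> x) * min (c x) (of_nat k)) \<partial>lebesgue)"
    proof (rule nn_integral_cong)
      fix x
      have "(SUP k::nat. min (c x) (of_nat k)) = c x"
        using inf_SUP[of "c x" "\<lambda>k. of_nat k :: ennreal" UNIV] by (simp add: inf_min ennreal_SUP_of_nat_eq_top)
      then show "ennreal (\<phi> x) * c x = (SUP k::nat. ennreal (\<phi> x) * min (c x) (of_nat k))"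
        by (simp add: SUP_mult_left_ennreal[symmetric])
    qed
    also have "\<dots> = (SUP k::nat. \<integral>\<^sup>+x. ennreal (\<phi> x) * min (c x) (of_nat k) \<partial>lebesgue)"
      by (intro nn_integral_monotone_convergence_SUP)
        (auto intro!: incseq_SucI le_funI mult_left_mono min.mono)
    also have "\<dots> \<le> ennreal s"
    proof (rule SUP_least)
      fix k :: nat
      define e where "e x = enn2real (min (c x) (of_nat k))" for x
      have [measurable]: "e \<in> borel_measurable lebesgue" unfolding e_def by measurable
      have fin: "min (c x) (of_nat k) < top" for x
        by (simp add: min_less_iff_disj of_nat_less_top)
      then have e: "ennreal (e x) = min (c x) (of_nat k)" for x
        by (simp add: e_def)
      have ek: "0 \<le> e x" "e x \<le> real k" for x
      proof -
        show "0 \<le> e x" by (simp add: e_def)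
        have "ennreal (e x) \<le> ennreal (real k)"
          unfolding e by (simp add: ennreal_of_nat_eq_real_of_nat[symmetric])
        then show "e x \<le> real k" by (simp add: ennreal_le_iff)
      qed
      have "N (\<lambda>x. ennreal (e x)) \<le> N c"
        unfolding e by (rule ball_qbfs_mono[OF Q]) auto
      then have eN: "N (\<lambda>x. ennreal (e x)) \<le> 1" using cN by order
      have "(\<integral>\<^sup>+x. ennreal (\<phi> x) * min (c x) (of_nat k) \<partial>lebesgue) = (\<integral>\<^sup>+x. ennreal (\<phi> x * e x) \<partial>lebesgue)"
        using \<phi> ek by (simp add: e ennreal_mult)
      also have "\<dots> = ennreal (\<integral>x. \<phi> x * e x \<partial>lebesgue)"
        using \<phi> ek by (intro nn_integral_eq_integral int[where k="real k"]) auto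
      also have "\<dots> \<le> ennreal s"
        by (intro ennreal_leI bdd_case[where k="real k"]) (use ek eN in auto)
      finally show "(\<integral>\<^sup>+x. ennreal (\<phi> x) * min (c x) (of_nat k) \<partial>lebesgue) \<le> ennreal s" .
    qed
    finally show ?thesis .
  qed
  have \<phi>_int: "integrable lebesgue (\<lambda>x. \<phi> x * 1)"
    by (rule int[where k=1]) auto
  have not_AE: "\<not> (AE x in lebesgue. \<phi> x = 0)"
  proof
    assume "AE x in lebesgue. \<phi> x = 0"
    then have "AE x in lebesgue. ennreal (g x) \<le> ennreal (b x)"
      by eventually_elim (simp add: \<phi>_def)
    then have "N (\<lambda>x. ennreal (g x)) \<le> N (\<lambda>x. ennreal (b x))"
      by (intro ball_qbfs_mono[OF Q]) auto
    with bN gN show False by order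
  qed
  \<comment> \<open>Test with a small multiple of the indicator of \<open>{l..u}\<close>: the factor
    \<open>\<epsilon>\<close> puts it in the unit ball, and \<open>\<phi>\<close>, which lives on
    this interval and is not a.e. zero, pairs positively with it.\<close>
  have s_pos: "s > 0"
  proof -
    let ?i = "indicator {l..u} :: real \<Rightarrow> ennreal"
    have fin: "N ?i < top" using ball_qbfs_indicator[OF Q] by simp
    define \<epsilon> where "\<epsilon> = 1 / (enn2real (N ?i) + 1)"
    have \<epsilon>: "\<epsilon> > 0" by (simp add: \<epsilon>_def add_nonneg_pos)
    have "N (\<lambda>x. ennreal \<epsilon> * ?i x) = ennreal \<epsilon> * N ?i"
      using \<epsilon> by (intro ball_qbfs_scale[OF Q]) auto
    also have "\<dots> = ennreal (\<epsilon> * enn2real (N ?i))"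
      using fin \<epsilon> by (simp add: ennreal_mult)
    also have "\<dots> \<le> 1"
      by (simp add: \<epsilon>_def divide_le_eq not_less add_nonneg_nonneg)
    finally have "(\<integral>\<^sup>+x. ennreal (\<phi> x) * (ennreal \<epsilon> * ?i x) \<partial>lebesgue) \<le> ennreal s"
      by (intro gen) auto
    moreover have "(\<integral>\<^sup>+x. ennreal (\<phi> x) * (ennreal \<epsilon> * ?i x) \<partial>lebesgue) \<noteq> 0"
    proof
      assume "(\<integral>\<^sup>+x. ennreal (\<phi> x) * (ennreal \<epsilon> * ?i x) \<partial>lebesgue) = 0"
      then have "AE x in lebesgue. ennreal (\<phi> x) * (ennreal \<epsilon> * ?i x) = 0"
        by (subst (asm) nn_integral_0_iff_AE) auto
      then have "AE x in lebesgue. \<phi> x = 0"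
      proof eventually_elim
        case (elim x)
        then show ?case
          using \<epsilon> \<phi>(1)[of x] outside(3)[of x] by (cases "x \<in> {l..u}") (auto simp: ennreal_eq_0_iff)
      qed
      with not_AE show False by simp
    qed
    ultimately show "s > 0"
      by (metis ennreal_neg le_zero_eq linorder_not_le order.strict_implies_order ennreal_0 order_le_less)
  qed
  define h where "h x = ennreal (\<phi> x / s)" for x
  show thesis
  proof
    show [measurable]: "h \<in> borel_measurable lebesgue" unfolding h_def by measurable
    have h_eq: "h x = ennreal (1 / s) * ennreal (\<phi> x)" for x
      using s_pos \<phi> by (simp add: h_def flip: ennreal_mult)
    show "assoc_space N h \<le> 1"
      unfolding assoc_space_def
    proof (rule SUP_least, clarify)
      fix c assume [measurable]: "c \<in> borel_measurable lebesgue" and cN: "N c = 1"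
      have "(\<integral>\<^sup>+x. h x * c x \<partial>lebesgue) = ennreal (1/s) * (\<integral>\<^sup>+x. ennreal (\<phi> x) * c x \<partial>lebesgue)"
        unfolding h_eq by (simp add: nn_integral_cmult mult.assoc)
      also have "\<dots> \<le> ennreal (1/s) * ennreal s"
        using cN by (intro mult_left_mono gen) auto
      also have "\<dots> = 1" using s_pos by (simp flip: ennreal_mult)
      finally show "(\<integral>\<^sup>+x. h x * c x \<partial>lebesgue) \<le> 1" .
    qed
    have "(\<integral>\<^sup>+x. ennreal (g x) * h x \<partial>lebesgue) = (\<integral>\<^sup>+x. ennreal (1/s * (\<phi> x * g x)) \<partial>lebesgue)"
      using s_pos \<phi> g by (intro nn_integral_cong) (simp add: h_def mult.commute flip: ennreal_mult)
    also have "\<dots> = ennreal (\<integral>x. 1/s * (\<phi> x * g x) \<partial>lebesgue)"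
      using bB s_pos \<phi> g by (intro nn_integral_eq_integral integrable_mult_right int[where k=B]) auto
    \<comment> \<open>Since \<open>g = b + \<phi>\<close>, the pairing is 1 plus the integral of
      \<open>\<phi> x * \<phi> x\<close> divided by \<open>s\<close>, hence above 1.\<close>
    also have "(\<integral>x. 1/s * (\<phi> x * g x) \<partial>lebesgue) = 1/s * (\<integral>x. \<phi> x * b x + \<phi> x * \<phi> x \<partial>lebesgue)"
      unfolding integral_mult_right_zero by (simp add: \<phi>_def algebra_simps)
    also have "(\<integral>x. \<phi> x * b x + \<phi> x * \<phi> x \<partial>lebesgue) = s + (\<integral>x. \<phi> x * \<phi> x \<partial>lebesgue)"
      unfolding s_def using bB by (intro Bochner_Integration.integral_add int) auto
    also have "1 / s * (s + (\<integral>x. \<phi> x * \<phi> x \<partial>lebesgue)) > 1"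
    proof -
      have int_sq: "integrable lebesgue (\<lambda>x. \<phi> x * \<phi> x)"
        using bB by (intro int) auto
      then have "(\<integral>x. \<phi> x * \<phi> x \<partial>lebesgue) \<noteq> 0"
        using not_AE by (subst integral_nonneg_eq_0_iff_AE) auto
      moreover have "(\<integral>x. \<phi> x * \<phi> x \<partial>lebesgue) \<ge> 0" by simp
      ultimately have "(\<integral>x. \<phi> x * \<phi> x \<partial>lebesgue) > 0" by linarith
      then show ?thesis using s_pos by (simp add: field_simps)
    qed
    then have "ennreal (1 / s * (s + (\<integral>x. \<phi> x * \<phi> x \<partial>lebesgue))) > 1"
      by (simp add: ennreal_1[symmetric] ennreal_less_iff del: ennreal_1)
    finally show "(\<integral>\<^sup>+x. ennreal (g x) * h x \<partial>lebesgue) > 1" .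
  qed
qed

text \<open>The Lorentz--Luxemburg theorem \<open>N'' = N\<close>, in the direction that needs convexity and the
  Fatou property.\<close>

lemma ball_bfs_norm_le_by_duality:
  assumes N: "ball_bfs N" and [measurable]: "g \<in> borel_measurable lebesgue"
    and dual: "\<And>h. h \<in> borel_measurable lebesgue \<Longrightarrow> assoc_space N h \<le> 1 \<Longrightarrow>
      (\<integral>\<^sup>+x. g x * h x \<partial>lebesgue) \<le> s"
  shows "N g \<le> s"
proof (rule ccontr)
  note Q = ball_bfs_qbfs[OF N]
  assume "\<not> N g \<le> s"
  then have "s < N g" by simp
  \<comment> \<open>The intermediate value is positive and finite even if \<open>N g\<close> is
    infinite, so it can serve as a scaling factor.\<close>
  then obtain r' where r': "s < r'" "r' < N g" using dense by blast
  then have "0 < r'" "r' < top" by (auto simp: order_le_less_trans less_le_trans)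
  then obtain r where r: "r' = ennreal r" "r > 0"
    by (cases r' rule: ennreal_cases) auto
  \<comment> \<open>Cutting in height and in space produces the bounded functions on an interval
    that separation handles. They increase to \<open>g\<close>, so some \<open>N (G n)\<close>
    exceeds \<open>r'\<close>.\<close>
  define G where "G n x = min (g x) (of_nat n) * indicator {- real n..real n} x" for n :: nat and x
  have [measurable]: "G n \<in> borel_measurable lebesgue" for n unfolding G_def by measurable
  have "(\<lambda>n. N (G n)) \<longlonglongrightarrow> N g"
  proof (rule ball_qbfs_tendsto[OF Q])
    show "AE x in lebesgue. incseq (\<lambda>n. G n x) \<and> (\<lambda>n. G n x) \<longlonglongrightarrow> g x"
    proof (intro AE_I2 conjI)
      fix x
      show "incseq (\<lambda>n. G n x)"
        unfolding G_def by (intro incseq_SucI mult_mono min.mono) (auto split: split_indicator)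
      have "(SUP k::nat. min (g x) (of_nat k)) = g x"
        using inf_SUP[of "g x" "\<lambda>k. of_nat k :: ennreal" UNIV]
        by (simp add: inf_min ennreal_SUP_of_nat_eq_top)
      moreover have "(\<lambda>k. min (g x) (of_nat k)) \<longlonglongrightarrow> (SUP k::nat. min (g x) (of_nat k))"
        by (intro LIMSEQ_SUP incseq_SucI min.mono) auto
      ultimately have "(\<lambda>k. min (g x) (of_nat k)) \<longlonglongrightarrow> g x" by simp
      moreover have "\<forall>\<^sub>F n in sequentially. G n x = min (g x) (of_nat n)"
      proof -
        obtain m :: nat where "\<bar>x\<bar> \<le> real m" using real_arch_simple by blast
        then show ?thesis
          by (intro eventually_sequentiallyI[of m]) (auto simp: G_def indicator_def abs_le_iff)
      qed
      ultimately show "(\<lambda>n. G n x) \<longlonglongrightarrow> g x"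
        by (simp add: tendsto_cong)
    qed
  qed measurable
  then have "\<forall>\<^sub>F n in sequentially. r' < N (G n)" using r' by (intro order_tendstoD)
  then obtain n where n: "r' < N (G n)" by (auto simp: eventually_sequentially)
  define e where "e x = enn2real (G n x) / r" for x
  have [measurable]: "e \<in> borel_measurable lebesgue" unfolding e_def by measurable
  have "G n x \<le> of_nat n * indicator {- real n..real n} x" for x
    unfolding G_def by (intro mult_right_mono) auto
  then have Gle: "G n x \<le> ennreal (real n * indicator {- real n..real n} x)" for x
    by (simp add: ennreal_mult ennreal_indicator ennreal_of_nat_eq_real_of_nat)
  then have fin: "G n x < top" for x
    using ennreal_less_top order_le_less_trans by blast
  have e_eq: "ennreal (e x) = ennreal (1 / r) * G n x" for x
    using r fin[of x] by (simp add: e_def divide_inverse mult.commute ennreal_mult)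
  have "enn2real (G n x) \<le> real n * indicator {- real n..real n} x" for x
    using enn2real_mono[OF Gle ennreal_less_top, of x] by simp
  then have e_le: "e x \<le> real n / r * indicator {- real n..real n} x" for x
    using r by (simp add: e_def divide_right_mono)
  have "1 = ennreal (1 / r) * ennreal r" using r by (simp flip: ennreal_mult)
  also have "\<dots> < ennreal (1 / r) * N (G n)"
    using n r by (intro ennreal_mult_strict_left_mono) auto
  also have "\<dots> = N (\<lambda>x. ennreal (e x))"
    unfolding e_eq using r by (intro ball_qbfs_scale[OF Q, symmetric]) auto
  finally have "N (\<lambda>x. ennreal (e x)) > 1" .
  then obtain h where h [measurable]: "h \<in> borel_measurable lebesgue" and hN: "assoc_space N h \<le> 1"
    and gt: "(\<integral>\<^sup>+x. ennreal (e x) * h x \<partial>lebesgue) > 1"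
    using ball_bfs_separation[OF N _ _ e_le] r by (auto simp: e_def)
  have "(\<integral>\<^sup>+x. ennreal (e x) * h x \<partial>lebesgue) = ennreal (1 / r) * (\<integral>\<^sup>+x. G n x * h x \<partial>lebesgue)"
    unfolding e_eq by (simp add: nn_integral_cmult mult.assoc)
  also have "\<dots> \<le> ennreal (1 / r) * (\<integral>\<^sup>+x. g x * h x \<partial>lebesgue)"
    by (intro mult_left_mono nn_integral_mono mult_right_mono) (auto simp: G_def indicator_def)
  also have "\<dots> \<le> ennreal (1 / r) * ennreal r"
    using dual[OF h hN] r r' by (intro mult_left_mono) auto
  also have "\<dots> = 1" using r by (simp flip: ennreal_mult)
  finally show False using gt by simp
qed

section \<open>Pairing with the associate space, and the operator norm\<close>

lemma assoc_space_Holder: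
  assumes Q: "ball_qbfs N" and [measurable]: "F \<in> borel_measurable lebesgue" "h \<in> borel_measurable lebesgue"
    and fin: "N F < \<infinity>"
  shows "(\<integral>\<^sup>+x. F x * h x \<partial>lebesgue) \<le> N F * assoc_space N h"
proof (cases "N F = 0")
  \<comment> \<open>The associate norm tests functions of norm exactly 1, to which \<open>F\<close>
    cannot be scaled here; instead \<open>F\<close> vanishes a.e.\<close>
  case True
  then have "AE x in lebesgue. F x = 0" by (intro ball_qbfs_eq_0[OF Q]) auto
  then have "AE x in lebesgue. F x * h x = 0" by eventually_elim simp
  then show ?thesis by (simp add: nn_integral_0_iff_AE[THEN iffD2])
next
  case False
  define r where "r = enn2real (N F)"
  have r: "N F = ennreal r" "r > 0"
    using False fin by (auto simp: r_def enn2real_positive_iff zero_less_iff_neq_zero)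
  define b where "b x = ennreal (1 / r) * F x" for x
  have [measurable]: "b \<in> borel_measurable lebesgue" unfolding b_def by measurable
  have F_eq: "F x = ennreal r * b x" for x
    using r by (simp add: b_def flip: mult.assoc ennreal_mult)
  have "N b = ennreal (1 / r) * N F"
    unfolding b_def using r by (intro ball_qbfs_scale[OF Q]) auto
  also have "\<dots> = 1" using r by (simp flip: ennreal_mult)
  finally have "(\<integral>\<^sup>+x. h x * b x \<partial>lebesgue) \<le> assoc_space N h"
    unfolding assoc_space_def by (intro SUP_upper) simp
  then have "ennreal r * (\<integral>\<^sup>+x. h x * b x \<partial>lebesgue) \<le> N F * assoc_space N h"
    unfolding r(1) by (rule mult_left_mono) simp
  also have "ennreal r * (\<integral>\<^sup>+x. h x * b x \<partial>lebesgue) = (\<integral>\<^sup>+x. F x * h x \<partial>lebesgue)"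
    unfolding F_eq by (subst nn_integral_cmult[symmetric]) (simp_all add: mult_ac)
  finally show ?thesis .
qed

text \<open>\<open>max_opnorm\<close> is an infimum, so any larger number lies above an actual
  bound. Later estimates use the operator norm plus 1 and thereby avoid the question whether the
  infimum is attained.\<close>

lemma max_bounded_const_less:
  assumes "max_bounded N" "max_opnorm N < A"
  obtains C where "max_bounded_const N C" "C < A"
  using assms cInf_lessD[of "{C. max_bounded_const N C}" A]
  unfolding max_bounded_def max_opnorm_def by auto

subsection \<open>The maximal operator\<close>

text \<open>Each superlevel set is a union of open intervals, because \<open>x\<close> ranges over
  the interior of the averaging interval.\<close>

lemma HL_max_measurable [measurable]: "HL_max a \<in> borel_measurable borel"
proof (rule borel_measurableI_greater)
  fix c
  have "{x \<in> space borel. c < HL_max a x} = (\<Union>(s, t) \<in> {(s, t). c < ennreal (1 / (t - s)) *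
      (\<integral>\<^sup>+ y. a y * indicator {s..t} y \<partial>lebesgue)}. {s<..<t})"
    by (auto simp: HL_max_def less_SUP_iff) blast
  also have "open \<dots>" by auto
  then have "(\<Union>(s, t) \<in> {(s, t). c < ennreal (1 / (t - s)) *
      (\<integral>\<^sup>+ y. a y * indicator {s..t} y \<partial>lebesgue)}. {s<..<t}) \<in> sets borel" by simp
  finally show "{x \<in> space borel. c < HL_max a x} \<in> sets borel" .
qed

lemma HL_max_measurable_lebesgue [measurable]: "HL_max a \<in> borel_measurable lebesgue"
  by (simp add: measurable_completion)

text \<open>Allows a Lebesgue measurable function to be replaced by a Borel representative, for
  which Fubini on \<open>lborel\<close> is available.\<close>

lemma HL_max_cong_AE:
  assumes "AE x in lborel. a x = b x"
  shows "HL_max a = HL_max b"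
proof -
  have "(\<integral>\<^sup>+ y. a y * indicator S y \<partial>lebesgue) = (\<integral>\<^sup>+ y. b y * indicator S y \<partial>lebesgue)" for S
    unfolding nn_integral_completion
    by (rule nn_integral_cong_AE) (use assms in eventually_elim, simp)
  then show ?thesis by (simp add: HL_max_def fun_eq_iff)
qed

lemma nn_integral_interval_le_HL_max:
  assumes r: "r > 0"
  shows "(\<integral>\<^sup>+ y. a y * indicator {u - r..u + r} y \<partial>lebesgue) \<le> ennreal (2 * r) * HL_max a u"
proof -
  let ?I = "\<integral>\<^sup>+ y. a y * indicator {u - r..u + r} y \<partial>lebesgue"
  have "?I = ennreal (2 * r) * (ennreal (1 / (2 * r)) * ?I)"
    using r by (simp flip: mult.assoc ennreal_mult)
  also have "\<dots> \<le> ennreal (2 * r) * HL_max a u"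
    unfolding HL_max_def using r
    by (intro mult_left_mono SUP_upper2[of "(u - r, u + r)"]) auto
  finally show ?thesis .
qed

text \<open>The sum of the series with terms \<open>2 powr (d + 1) * (2 powr (1 - d)) ^ k\<close>,
  that is, dyadic kernel heights times interval lengths at unit radius.\<close>

definition HL_kernel_const :: "real \<Rightarrow> real" where
  "HL_kernel_const d = 2 powr (d + 1) / (1 - 2 powr (1 - d))"

lemma HL_kernel_const_pos: "d > 1 \<Longrightarrow> HL_kernel_const d > 0"
  using powr_less_mono[of "1 - d" 0 2] by (simp add: HL_kernel_const_def)

text \<open>A radially decreasing integrable kernel is dominated by a dyadic superposition of averages.\<close>

lemma nn_integral_kernel_le_HL_max:
  assumes r: "r > 0" and d: "d > 1" and [measurable]: "h \<in> borel_measurable lebesgue"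
  shows "(\<integral>\<^sup>+x. ennreal (max 1 (\<bar>x - u\<bar> / r) powr (- d)) * h x \<partial>lebesgue)
    \<le> ennreal (HL_kernel_const d * r) * HL_max h u"
proof -
  \<comment> \<open>For \<open>k > 0\<close> this is \<open>(2 ^ (k - 1)) powr (- d)\<close>, the
    kernel at the inner edge of the dyadic annulus of index \<open>k\<close>; for
    \<open>k = 0\<close> it is at least 1, which covers the core.\<close>
  define c where "c k = 2 powr d * (2 powr (- d)) ^ k" for k :: nat
  have c0: "0 \<le> c k" for k by (simp add: c_def)
  define J where "J k = {u - 2 ^ k * r..u + 2 ^ k * r}" for k :: nat
  have pt: "ennreal (max 1 (\<bar>x - u\<bar> / r) powr (- d)) \<le> (\<Sum>k. ennreal (c k) * indicator (J k) x)" for x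
  proof -
    define t where "t = \<bar>x - u\<bar> / r"
    define k where "k = (LEAST k::nat. t \<le> 2 ^ k)"
    have "\<exists>k::nat. t \<le> 2 ^ k"
      using real_arch_pow[of 2 t] by (auto intro: less_imp_le)
    then have tk: "t \<le> 2 ^ k" unfolding k_def by (rule LeastI_ex)
    have "max 1 t powr (- d) \<le> c k"
    proof (cases k)
      case 0
      have "max 1 t powr (- d) \<le> 1 powr (- d)"
        using d by (intro powr_mono2') auto
      also have "\<dots> \<le> 2 powr d" using d ge_one_powr_ge_zero[of 2 d] by simp
      finally show ?thesis by (simp add: c_def 0)
    next
      case (Suc j)
      have "\<not> t \<le> 2 ^ j" using not_less_Least[of j "\<lambda>k. t \<le> 2 ^ k"] Suc by (simp add: k_def)
      then have "max 1 t powr (- d) \<le> (2 ^ j) powr (- d)"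
        using d by (intro powr_mono2') auto
      also have "\<dots> = c k"
        by (simp add: c_def Suc powr_power powr_realpow[symmetric] powr_powr flip: powr_add)
           (simp add: algebra_simps)
      finally show ?thesis .
    qed
    moreover have "x \<in> J k"
    proof -
      have "\<bar>x - u\<bar> \<le> 2 ^ k * r" using tk r by (simp add: t_def divide_le_eq)
      then show ?thesis by (auto simp: J_def abs_le_iff)
    qed
    ultimately have "ennreal (max 1 t powr (- d)) \<le> ennreal (c k) * indicator (J k) x"
      by (simp add: ennreal_leI)
    also have "\<dots> \<le> (\<Sum>k. ennreal (c k) * indicator (J k) x)"
    proof -
      define f where "f k = ennreal (c k) * indicator (J k) x" for k
      have "sum f {k} \<le> suminf f" by (rule sum_le_suminf) auto
      then have "f k \<le> suminf f" by simp
      then show ?thesis unfolding f_def[abs_def] .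
    qed
    finally show ?thesis by (simp add: t_def)
  qed
  \<comment> \<open>The ratio of the series: heights shrink by \<open>2 powr (- d)\<close> while
    lengths double, so \<open>d > 1\<close> gives convergence.\<close>
  define q where "q = 2 powr (1 - d)"
  have q: "0 < q" "q < 1" using powr_less_mono[of "1 - d" 0 2] d by (auto simp: q_def)
  have "(\<integral>\<^sup>+x. ennreal (max 1 (\<bar>x - u\<bar> / r) powr (- d)) * h x \<partial>lebesgue)
      \<le> (\<integral>\<^sup>+x. (\<Sum>k. ennreal (c k) * (h x * indicator (J k) x)) \<partial>lebesgue)"
  proof (rule nn_integral_mono)
    fix x
    have "ennreal (max 1 (\<bar>x - u\<bar> / r) powr (- d)) * h x
        \<le> (\<Sum>k. ennreal (c k) * indicator (J k) x) * h x"
      by (intro mult_right_mono pt) simp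
    also have "\<dots> = (\<Sum>k. ennreal (c k) * (h x * indicator (J k) x))"
      by (subst ennreal_suminf_multc[symmetric]) (simp_all add: mult_ac)
    finally show "ennreal (max 1 (\<bar>x - u\<bar> / r) powr (- d)) * h x
        \<le> (\<Sum>k. ennreal (c k) * (h x * indicator (J k) x))" .
  qed
  also have "\<dots> = (\<Sum>k. ennreal (c k) * (\<integral>\<^sup>+x. h x * indicator (J k) x \<partial>lebesgue))"
    by (subst nn_integral_suminf) (auto simp: J_def nn_integral_cmult)
  also have "\<dots> \<le> (\<Sum>k. ennreal (c k) * (ennreal (2 * (2 ^ k * r)) * HL_max h u))"
    unfolding J_def using r by (intro suminf_le mult_left_mono nn_integral_interval_le_HL_max) auto
  also have "\<dots> = (\<Sum>k. ennreal (2 powr (d + 1) * r * q ^ k) * HL_max h u)"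
  proof (rule suminf_cong)
    fix k :: nat
    have "c k * (2 * (2 ^ k * r)) = 2 powr (d + 1) * r * q ^ k"
      by (simp add: c_def q_def powr_add powr_diff powr_minus power_mult_distrib power_divide divide_simps)
    moreover have "ennreal (c k) * (ennreal (2 * (2 ^ k * r)) * HL_max h u) =
        ennreal (c k * (2 * (2 ^ k * r))) * HL_max h u"
      using c0 r by (subst ennreal_mult[of "c k"]) (simp_all add: mult.assoc)
    ultimately show "ennreal (c k) * (ennreal (2 * (2 ^ k * r)) * HL_max h u) =
        ennreal (2 powr (d + 1) * r * q ^ k) * HL_max h u" by (simp only:)
  qed
  also have "\<dots> = (\<Sum>k. ennreal (2 powr (d + 1) * r * q ^ k)) * HL_max h u"
    by simp
  also have "(\<Sum>k. ennreal (2 powr (d + 1) * r * q ^ k)) = ennreal (\<Sum>k. 2 powr (d + 1) * r * q ^ k)"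
    using q r by (intro suminf_ennreal2 summable_mult summable_geometric) auto
  also have "(\<Sum>k. 2 powr (d + 1) * r * q ^ k) = HL_kernel_const d * r"
    using q by (subst suminf_mult) (auto simp: suminf_geometric HL_kernel_const_def q_def)
  finally show ?thesis .
qed

subsection \<open>Stopping radii\<close>

text \<open>In applications \<open>\<Phi>\<close> is an antiderivative of a nonnegative \<open>F\<close>, so that
  \<open>\<Phi> (x + r) - \<Phi> (x - r)\<close> is the mass of \<open>F\<close> on the ball of radius \<open>r\<close> about \<open>x\<close>.
  Since \<open>d > 1\<close>, the threshold \<open>L r powr (1 - d)\<close> decreases in \<open>r\<close>; this makes the
  stopping radius 1-Lipschitz.\<close>

locale stopping_radius =
  fixes \<Phi> :: "real \<Rightarrow> real" and L d T :: real
  assumes mono: "mono \<Phi>" and cont: "continuous_on UNIV \<Phi>"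
    and mass_le: "\<And>a b. \<Phi> b - \<Phi> a \<le> T" and nonconst: "\<exists>a b. \<Phi> a < \<Phi> b"
    and L: "L > 0" and d: "d > 1"
begin

definition admissible :: "real \<Rightarrow> real set" where
  "admissible x = {r. 0 < r \<and> L * r powr (1 - d) \<le> \<Phi> (x + r) - \<Phi> (x - r)}"

definition \<rho> :: "real \<Rightarrow> real" where
  "\<rho> x = Inf (admissible x)"

lemma T_pos: "T > 0"
proof -
  obtain a b where "\<Phi> a < \<Phi> b" using nonconst by blast
  with mass_le[of b a] show ?thesis by linarith
qed

text \<open>The mass is at most \<open>T\<close>, while the threshold blows up as \<open>r\<close>
  tends to 0 because \<open>d > 1\<close>. This keeps the infimum \<open>\<rho> x\<close>
  positive.\<close>

lemma admissible_ge:
  assumes "r \<in> admissible x"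
  shows "(L / T) powr (1 / (d - 1)) \<le> r"
proof -
  have r: "r > 0" "L * r powr (1 - d) \<le> T"
    using assms mass_le[of "x + r" "x - r"] by (auto simp: admissible_def)
  then have "L / T \<le> 1 / r powr (1 - d)"
    using T_pos by (simp add: field_simps)
  also have "\<dots> = r powr (d - 1)"
    using powr_minus_divide[of r "1 - d"] by simp
  finally have "(L / T) powr (1 / (d - 1)) \<le> (r powr (d - 1)) powr (1 / (d - 1))"
    using L T_pos d by (intro powr_mono2) auto
  also have "\<dots> = r" using r d by (simp add: powr_powr)
  finally show ?thesis .
qed

lemma admissible_bdd_below: "bdd_below (admissible x)"
  by (rule bdd_belowI[OF admissible_ge])

text \<open>As \<open>r\<close> grows the threshold tends to 0, whereas the ball eventually contains
  a fixed interval of positive mass.\<close>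

lemma admissible_nonempty: "admissible x \<noteq> {}"
proof -
  obtain a b where ab: "\<Phi> a < \<Phi> b" using nonconst by blast
  define R where "R = \<bar>x\<bar> + \<bar>a\<bar> + \<bar>b\<bar> + 1"
  have mass: "\<Phi> b - \<Phi> a \<le> \<Phi> (x + r) - \<Phi> (x - r)" if "R \<le> r" for r
  proof -
    have "\<Phi> b \<le> \<Phi> (x + r)" "\<Phi> (x - r) \<le> \<Phi> a"
      using that by (auto simp: R_def intro!: monoD[OF mono])
    then show ?thesis by simp
  qed
  have "((\<lambda>r. L * r powr (1 - d)) \<longlongrightarrow> L * 0) at_top"
    using d by (intro tendsto_intros tendsto_neg_powr filterlim_ident) auto
  then have "\<forall>\<^sub>F r in at_top. L * r powr (1 - d) < \<Phi> b - \<Phi> a"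
    using ab by (intro order_tendstoD) auto
  then have "\<forall>\<^sub>F r in at_top. r \<in> admissible x"
    using eventually_ge_at_top[of R] eventually_gt_at_top[of 0]
  proof eventually_elim
    case (elim r)
    then show ?case using mass[of r] by (simp add: admissible_def)
  qed
  then show ?thesis
    by (auto simp: eventually_at_top_linorder)
qed

lemma admissible_closed: "closed (admissible x)"
proof -
  \<comment> \<open>Working on \<open>{?r0..}\<close> stays away from 0, where
    \<open>r powr (1 - d)\<close> is discontinuous.\<close>
  let ?r0 = "(L / T) powr (1 / (d - 1))"
  have r0: "?r0 > 0" using L T_pos by simp
  have "closed {r \<in> {?r0..}. L * r powr (1 - d) \<le> \<Phi> (x + r) - \<Phi> (x - r)}"
  proof (rule continuous_on_closed_Collect_le)
    show "continuous_on {?r0..} (\<lambda>r. L * r powr (1 - d))"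
      using r0 by (intro continuous_intros) auto
    show "continuous_on {?r0..} (\<lambda>r. \<Phi> (x + r) - \<Phi> (x - r))"
      by (intro continuous_intros continuous_on_compose2[OF cont]) auto
  qed auto
  also have "{r \<in> {?r0..}. L * r powr (1 - d) \<le> \<Phi> (x + r) - \<Phi> (x - r)} = admissible x"
  proof (intro equalityI subsetI)
    fix r assume "r \<in> {r \<in> {?r0..}. L * r powr (1 - d) \<le> \<Phi> (x + r) - \<Phi> (x - r)}"
    then show "r \<in> admissible x" 
      using less_le_trans[OF r0, of r] unfolding admissible_def mem_Collect_eq atLeast_iff by blast
  next
    fix r assume r: "r \<in> admissible x"
    from admissible_ge[OF this] r
    show "r \<in> {r \<in> {?r0..}. L * r powr (1 - d) \<le> \<Phi> (x + r) - \<Phi> (x - r)}"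
      unfolding admissible_def mem_Collect_eq atLeast_iff by blast
  qed
  finally show ?thesis .
qed

lemma \<rho>_admissible: "\<rho> x \<in> admissible x"
  unfolding \<rho>_def
  by (rule closed_contains_Inf[OF admissible_nonempty admissible_bdd_below admissible_closed])

lemma \<rho>_pos: "\<rho> x > 0"
  and \<rho>_mass: "L * \<rho> x powr (1 - d) \<le> \<Phi> (x + \<rho> x) - \<Phi> (x - \<rho> x)"
  using \<rho>_admissible[of x] by (auto simp: admissible_def)

lemma \<rho>_le: "r > 0 \<Longrightarrow> L * r powr (1 - d) \<le> \<Phi> (x + r) - \<Phi> (x - r) \<Longrightarrow> \<rho> x \<le> r"
  unfolding \<rho>_def by (rule cInf_lower[OF _ admissible_bdd_below]) (simp add: admissible_def)

text \<open>The ball of radius \<open>\<rho> x + \<bar>x - y\<bar>\<close> about \<open>y\<close>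
  contains the stopping ball about \<open>x\<close>, and the threshold is no larger at this larger
  radius, so the radius is admissible for \<open>y\<close>.\<close>

lemma \<rho>_Lipschitz: "\<rho> y \<le> \<rho> x + \<bar>x - y\<bar>"
proof (rule \<rho>_le)
  show "0 < \<rho> x + \<bar>x - y\<bar>" using \<rho>_pos[of x] by simp
  have "L * (\<rho> x + \<bar>x - y\<bar>) powr (1 - d) \<le> L * \<rho> x powr (1 - d)"
    using L d \<rho>_pos[of x] by (intro mult_left_mono powr_mono2') auto
  also have "\<dots> \<le> \<Phi> (x + \<rho> x) - \<Phi> (x - \<rho> x)" by (rule \<rho>_mass)
  also have "\<dots> \<le> \<Phi> (y + (\<rho> x + \<bar>x - y\<bar>)) - \<Phi> (y - (\<rho> x + \<bar>x - y\<bar>))"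
    by (rule diff_mono; rule monoD[OF mono]; linarith)
  finally show "L * (\<rho> x + \<bar>x - y\<bar>) powr (1 - d)
      \<le> \<Phi> (y + (\<rho> x + \<bar>x - y\<bar>)) - \<Phi> (y - (\<rho> x + \<bar>x - y\<bar>))" .
qed

lemma \<rho>_continuous: "continuous_on S \<rho>"
proof (rule continuous_onI)
  fix x e :: real assume "0 < e"
  then show "\<exists>\<delta>>0. \<forall>x'\<in>S. dist x' x < \<delta> \<longrightarrow> dist (\<rho> x') (\<rho> x) \<le> e"
  proof (intro exI[of _ e] conjI ballI impI)
    fix x' assume "dist x' x < e"
    then show "dist (\<rho> x') (\<rho> x) \<le> e"
      using \<rho>_Lipschitz[of x x'] \<rho>_Lipschitz[of x' x] by (simp add: dist_real_def)
  qed
qed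

lemma \<rho>_measurable [measurable]: "\<rho> \<in> borel_measurable borel"
  by (intro borel_measurable_continuous_onI \<rho>_continuous)

text \<open>The minimality of \<open>z\<close> prevents the stopping radius from collapsing on the ball about \<open>z\<close>.\<close>

lemma ex_stable_centre:
  obtains z where "\<bar>x - z\<bar> \<le> 2 * \<rho> x" "\<rho> z \<le> \<rho> x"
    "\<And>u. \<bar>u - z\<bar> \<le> \<rho> z \<Longrightarrow> \<rho> z / 2 \<le> \<rho> u"
proof -
  \<comment> \<open>Farther than \<open>2 * \<rho> x\<close> from \<open>x\<close> the penalty alone
    exceeds \<open>\<psi> x = \<rho> x\<close>, so a minimum over the closed ball is global. A move
    from \<open>z\<close> by at most \<open>\<rho> z\<close> raises the penalty by at most
    \<open>\<rho> z / 2\<close>, which leaves at least \<open>\<rho> z / 2\<close> for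
    \<open>\<rho> u\<close>.\<close>
  define \<psi> where "\<psi> w = \<rho> w + \<bar>x - w\<bar> / 2" for w
  have "\<exists>z\<in>cball x (2 * \<rho> x). \<forall>w\<in>cball x (2 * \<rho> x). \<psi> z \<le> \<psi> w"
    unfolding \<psi>_def using \<rho>_pos[of x]
    by (intro continuous_attains_inf continuous_intros \<rho>_continuous) auto
  then obtain z where "\<forall>w\<in>cball x (2 * \<rho> x). \<psi> z \<le> \<psi> w" by blast
  then have z: "\<psi> z \<le> \<psi> w" if "\<bar>x - w\<bar> \<le> 2 * \<rho> x" for w
    using that by (simp add: dist_real_def)
  have z_x: "\<psi> z \<le> \<rho> x" using z[of x] \<rho>_pos[of x] by (simp add: \<psi>_def)
  have min: "\<psi> z \<le> \<psi> w" for w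
  proof (cases "\<bar>x - w\<bar> \<le> 2 * \<rho> x")
    case False
    then show ?thesis using z_x \<rho>_pos[of w] by (simp add: \<psi>_def)
  qed (rule z)
  show thesis
  proof
    show "\<bar>x - z\<bar> \<le> 2 * \<rho> x" "\<rho> z \<le> \<rho> x"
      using z_x \<rho>_pos[of z] unfolding \<psi>_def by (smt (verit) field_sum_of_halves)+
    show "\<rho> z / 2 \<le> \<rho> u" if "\<bar>u - z\<bar> \<le> \<rho> z" for u
      using min[of u] that unfolding \<psi>_def by (smt (verit) field_sum_of_halves)
  qed
qed

text \<open>On the stable ball of centre \<open>z\<close> and radius \<open>s = \<rho> z\<close> the
  kernel divided by \<open>\<rho> u\<close> is at least the constant \<open>c\<close>, and the mass
  there is at least \<open>L * s powr (1 - d)\<close>. The powers of \<open>s\<close>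
  cancel.\<close>

lemma stopping_radius_le_kernel_integral:
  assumes F: "\<And>u. (\<Phi> has_real_derivative F u) (at u)" "\<And>u. 0 \<le> F u"
    and [measurable]: "F \<in> borel_measurable borel"
  shows "ennreal (L * \<rho> x powr (- d)) \<le> ennreal (2 powr (3 * d - 1)) *
    (\<integral>\<^sup>+u. ennreal (F u / \<rho> u * max 1 (\<bar>x - u\<bar> / \<rho> u) powr (- d)) \<partial>lborel)"
proof -
  obtain z where z: "\<bar>x - z\<bar> \<le> 2 * \<rho> x" "\<rho> z \<le> \<rho> x"
    "\<And>u. \<bar>u - z\<bar> \<le> \<rho> z \<Longrightarrow> \<rho> z / 2 \<le> \<rho> u"
    using ex_stable_centre[of x] by blast
  define s where "s = \<rho> z"
  have s: "s > 0" using \<rho>_pos by (simp add: s_def)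
  \<comment> \<open>Results from bounding the maximum by \<open>4 * \<rho> x / \<rho> u\<close> and
    then \<open>\<rho> u\<close> from below by \<open>s / 2\<close>, which is legitimate as the
    remaining exponent \<open>d - 1\<close> is positive.\<close>
  define c where "c = 4 powr (- d) * \<rho> x powr (- d) * (s / 2) powr (d - 1)"
  have c: "c \<ge> 0" by (simp add: c_def)
  have lower: "c \<le> max 1 (\<bar>x - u\<bar> / \<rho> u) powr (- d) / \<rho> u" if "u \<in> {z - s..z + s}" for u
  proof -
    have uz: "\<bar>u - z\<bar> \<le> s" using that by (auto simp: abs_le_iff)
    \<comment> \<open>At most \<open>2 * \<rho> x\<close> to reach \<open>z\<close> and
      \<open>\<rho> z \<le> \<rho> x\<close> from there to \<open>u\<close>; the Lipschitz bound
      adds one more \<open>\<rho> x\<close> for \<open>\<rho> u\<close>.\<close>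
    then have "\<bar>x - u\<bar> \<le> 3 * \<rho> x" using z(1,2) by (simp add: s_def)
    moreover have "\<rho> u \<le> 4 * \<rho> x" using \<rho>_Lipschitz[of u x] calculation by simp
    ultimately have "max 1 (\<bar>x - u\<bar> / \<rho> u) \<le> 4 * \<rho> x / \<rho> u"
      using \<rho>_pos[of u] \<rho>_pos[of x] by (auto simp: field_simps)
    then have "(4 * \<rho> x / \<rho> u) powr (- d) \<le> max 1 (\<bar>x - u\<bar> / \<rho> u) powr (- d)"
      using d by (intro powr_mono2') auto
    then have "(4 * \<rho> x / \<rho> u) powr (- d) / \<rho> u \<le> max 1 (\<bar>x - u\<bar> / \<rho> u) powr (- d) / \<rho> u"
      using \<rho>_pos[of u] by (intro divide_right_mono) auto
    moreover have "(4 * \<rho> x / \<rho> u) powr (- d) / \<rho> u = 4 powr (- d) * \<rho> x powr (- d) * \<rho> u powr (d - 1)"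
      using \<rho>_pos[of u] \<rho>_pos[of x]
      by (simp add: powr_divide powr_mult powr_minus powr_diff divide_simps)
    moreover have "(s / 2) powr (d - 1) \<le> \<rho> u powr (d - 1)"
      using z(3)[of u] uz s d by (intro powr_mono2) (auto simp: s_def)
    then have "c \<le> 4 powr (- d) * \<rho> x powr (- d) * \<rho> u powr (d - 1)"
      unfolding c_def by (intro mult_left_mono) auto
    ultimately show ?thesis by linarith
  qed
  have "ennreal (c * (\<Phi> (z + s) - \<Phi> (z - s))) = ennreal c * (\<integral>\<^sup>+u. ennreal (F u) * indicator {z - s..z + s} u \<partial>lborel)"
  proof -
    have "(\<integral>\<^sup>+u. ennreal (F u) * indicator {z - s..z + s} u \<partial>lborel) = ennreal (\<Phi> (z + s) - \<Phi> (z - s))"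
      using s F by (intro nn_integral_FTC_Icc) auto
    moreover have "\<Phi> (z - s) \<le> \<Phi> (z + s)" using s by (intro monoD[OF mono]) auto
    ultimately show ?thesis using c by (simp add: ennreal_mult)
  qed
  also have "\<dots> = (\<integral>\<^sup>+u. ennreal c * (ennreal (F u) * indicator {z - s..z + s} u) \<partial>lborel)"
    by (rule nn_integral_cmult[symmetric]) simp
  also have "\<dots> \<le> (\<integral>\<^sup>+u. ennreal (F u / \<rho> u * max 1 (\<bar>x - u\<bar> / \<rho> u) powr (- d)) \<partial>lborel)"
  proof (rule nn_integral_mono)
    fix u
    have "c * F u \<le> F u / \<rho> u * max 1 (\<bar>x - u\<bar> / \<rho> u) powr (- d)" if "u \<in> {z - s..z + s}"
      using mult_left_mono[OF lower[OF that] F(2)[of u]] by (simp add: mult_ac)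
    then show "ennreal c * (ennreal (F u) * indicator {z - s..z + s} u)
        \<le> ennreal (F u / \<rho> u * max 1 (\<bar>x - u\<bar> / \<rho> u) powr (- d))"
      using c F(2) by (auto simp: indicator_def ennreal_mult[symmetric] intro!: ennreal_leI)
  qed
  finally have 1: "ennreal (c * (\<Phi> (z + s) - \<Phi> (z - s))) \<le>
    (\<integral>\<^sup>+u. ennreal (F u / \<rho> u * max 1 (\<bar>x - u\<bar> / \<rho> u) powr (- d)) \<partial>lborel)" .
  \<comment> \<open>\<open>c\<close> carries the factors \<open>2 powr (- (2 * d))\<close> and
    \<open>2 powr (1 - d)\<close>; the exponent \<open>3 * d - 1\<close> offsets their
    product.\<close>
  have "L * \<rho> x powr (- d) = 2 powr (3 * d - 1) * (c * (L * s powr (1 - d)))"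
  proof -
    have "4 powr (- d) = (2 powr (- (2 * d)) :: real)"
      using powr_powr[of 2 2 "- d"] by simp
    moreover have "(s / 2) powr (d - 1) = s powr (d - 1) * 2 powr (1 - d)"
      using powr_minus_divide[of 2 "d - 1"] s by (simp add: powr_divide)
    ultimately have "2 powr (3 * d - 1) * (c * (L * s powr (1 - d))) =
        L * \<rho> x powr (- d) * (2 powr (3 * d - 1) * 2 powr (- (2 * d)) * 2 powr (1 - d)) * (s powr (d - 1) * s powr (1 - d))"
      by (simp add: c_def)
    also have "\<dots> = L * \<rho> x powr (- d)"
      using s by (simp flip: powr_add)
    finally show ?thesis by (rule sym)
  qed
  also have "\<dots> \<le> 2 powr (3 * d - 1) * (c * (\<Phi> (z + s) - \<Phi> (z - s)))"
    using c \<rho>_mass[of z] by (intro mult_left_mono) (auto simp: s_def)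
  finally have "ennreal (L * \<rho> x powr (- d)) \<le> ennreal (2 powr (3 * d - 1)) * ennreal (c * (\<Phi> (z + s) - \<Phi> (z - s)))"
    by (simp add: ennreal_leI ennreal_mult'[symmetric])
  also have "\<dots> \<le> ennreal (2 powr (3 * d - 1)) *
    (\<integral>\<^sup>+u. ennreal (F u / \<rho> u * max 1 (\<bar>x - u\<bar> / \<rho> u) powr (- d)) \<partial>lborel)"
    by (intro mult_left_mono 1) simp
  finally show ?thesis .
qed

text \<open>Tonelli moves the integration in \<open>x\<close> inside. For fixed \<open>u\<close> the
  kernel is a radial bump in \<open>x\<close> of width \<open>\<rho> u\<close>, so its integral
  against \<open>h\<close> is at most a constant times \<open>\<rho> u * HL_max h u\<close>, and
  \<open>\<rho> u\<close> cancels the weight \<open>1 / \<rho> u\<close>.\<close>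

lemma nn_integral_stopping_radius_le:
  assumes F: "\<And>u. (\<Phi> has_real_derivative F u) (at u)" "\<And>u. 0 \<le> F u"
    and [measurable]: "F \<in> borel_measurable borel" and h: "h \<in> borel_measurable lebesgue"
  shows "(\<integral>\<^sup>+x. ennreal (L * \<rho> x powr (- d)) * h x \<partial>lebesgue) \<le>
    ennreal (2 powr (3 * d - 1) * HL_kernel_const d) * (\<integral>\<^sup>+u. ennreal (F u) * HL_max h u \<partial>lebesgue)"
proof -
  obtain h' where [measurable]: "h' \<in> borel_measurable lborel" and h': "AE x in lborel. h x = h' x"
    using completion_ex_borel_measurable[OF h] by blast
  have [measurable]: "h' \<in> borel_measurable borel" using \<open>h' \<in> borel_measurable lborel\<close> by simp
  let ?k = "\<lambda>x u. max 1 (\<bar>x - u\<bar> / \<rho> u) powr (- d)"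
  have "(\<integral>\<^sup>+x. ennreal (L * \<rho> x powr (- d)) * h x \<partial>lebesgue)
      = (\<integral>\<^sup>+x. ennreal (L * \<rho> x powr (- d)) * h' x \<partial>lborel)"
    unfolding nn_integral_completion by (rule nn_integral_cong_AE) (use h' in eventually_elim, simp)
  also have "\<dots> \<le> (\<integral>\<^sup>+x. (ennreal (2 powr (3 * d - 1)) * (\<integral>\<^sup>+u. ennreal (F u / \<rho> u * ?k x u) \<partial>lborel)) * h' x \<partial>lborel)"
    by (intro nn_integral_mono mult_right_mono stopping_radius_le_kernel_integral F) auto
  also have "\<dots> = ennreal (2 powr (3 * d - 1)) * (\<integral>\<^sup>+x. \<integral>\<^sup>+u. ennreal (F u / \<rho> u * ?k x u) * h' x \<partial>lborel \<partial>lborel)"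
    by (simp add: mult.assoc nn_integral_multc nn_integral_cmult)
  finally have reduce: "(\<integral>\<^sup>+x. ennreal (L * \<rho> x powr (- d)) * h x \<partial>lebesgue) \<le>
      ennreal (2 powr (3 * d - 1)) * (\<integral>\<^sup>+x. \<integral>\<^sup>+u. ennreal (F u / \<rho> u * ?k x u) * h' x \<partial>lborel \<partial>lborel)" .
  have "(\<integral>\<^sup>+x. \<integral>\<^sup>+u. ennreal (F u / \<rho> u * ?k x u) * h' x \<partial>lborel \<partial>lborel)
      = (\<integral>\<^sup>+u. \<integral>\<^sup>+x. ennreal (F u / \<rho> u * ?k x u) * h' x \<partial>lborel \<partial>lborel)"
    by (rule lborel_pair.Fubini') measurable
  also have "\<dots> \<le> (\<integral>\<^sup>+u. ennreal (HL_kernel_const d) * (ennreal (F u) * HL_max h' u) \<partial>lborel)"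
  proof (rule nn_integral_mono)
    fix u
    have "(\<integral>\<^sup>+x. ennreal (F u / \<rho> u * ?k x u) * h' x \<partial>lborel) = ennreal (F u / \<rho> u) * (\<integral>\<^sup>+x. ennreal (?k x u) * h' x \<partial>lborel)"
    proof -
      have "ennreal (F u / \<rho> u * ?k x u) * h' x = ennreal (F u / \<rho> u) * (ennreal (?k x u) * h' x)" for x
        using F(2)[of u] \<rho>_pos[of u] by (subst ennreal_mult) (auto simp: mult.assoc)
      then show ?thesis by (simp only:) (rule nn_integral_cmult, measurable)
    qed
    also have "\<dots> \<le> ennreal (F u / \<rho> u) * (ennreal (HL_kernel_const d * \<rho> u) * HL_max h' u)"
      using nn_integral_kernel_le_HL_max[OF \<rho>_pos[of u] d, of h' u]
      by (intro mult_left_mono) (simp_all add: nn_integral_completion measurable_completion)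
    also have "\<dots> = ennreal (HL_kernel_const d) * (ennreal (F u) * HL_max h' u)"
    proof -
      have "ennreal (F u / \<rho> u) * ennreal (HL_kernel_const d * \<rho> u)
          = ennreal (F u / \<rho> u * (HL_kernel_const d * \<rho> u))"
        using F(2)[of u] \<rho>_pos[of u] HL_kernel_const_pos[OF d] by (intro ennreal_mult[symmetric]) auto
      also have "F u / \<rho> u * (HL_kernel_const d * \<rho> u) = HL_kernel_const d * F u"
        using \<rho>_pos[of u] by simp
      also have "ennreal \<dots> = ennreal (HL_kernel_const d) * ennreal (F u)"
        using F(2)[of u] HL_kernel_const_pos[OF d] by (intro ennreal_mult) auto
      finally show ?thesis by (simp only: mult.assoc[symmetric])
    qed
    finally show "(\<integral>\<^sup>+x. ennreal (F u / \<rho> u * ?k x u) * h' x \<partial>lborel)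
        \<le> ennreal (HL_kernel_const d) * (ennreal (F u) * HL_max h' u)" .
  qed
  also have "\<dots> = ennreal (HL_kernel_const d) * (\<integral>\<^sup>+u. ennreal (F u) * HL_max h u \<partial>lebesgue)"
    unfolding HL_max_cong_AE[OF h'] nn_integral_completion by (rule nn_integral_cmult) measurable
  finally have swapped: "(\<integral>\<^sup>+x. \<integral>\<^sup>+u. ennreal (F u / \<rho> u * ?k x u) * h' x \<partial>lborel \<partial>lborel)
      \<le> ennreal (HL_kernel_const d) * (\<integral>\<^sup>+u. ennreal (F u) * HL_max h u \<partial>lebesgue)" .
  show ?thesis
    using order_trans[OF reduce mult_left_mono[OF swapped]] HL_kernel_const_pos[OF d]
    by (simp add: ennreal_mult mult.assoc)
qed

end

text \<open>Duality moves the maximal operator onto the test function \<open>h\<close>, in the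
  associate space where it is bounded; the Hoelder inequality for \<open>F\<close> and
  \<open>HL_max h\<close> then returns the norm of \<open>F\<close>.\<close>

lemma (in stopping_radius) norm_stopping_radius_le:
  assumes Y: "ball_bfs Y" and M: "max_bounded (assoc_space Y)"
    and F: "\<And>u. (\<Phi> has_real_derivative F u) (at u)" "\<And>u. 0 \<le> F u"
    and [measurable]: "F \<in> borel_measurable borel" and fin: "Y (\<lambda>x. ennreal (F x)) < \<infinity>"
  shows "Y (\<lambda>x. ennreal (L * \<rho> x powr (- d))) \<le>
    ennreal (2 powr (3 * d - 1) * HL_kernel_const d * (max_opnorm (assoc_space Y) + 1)) * Y (\<lambda>x. ennreal (F x))"
proof (rule ball_bfs_norm_le_by_duality[OF Y])
  let ?m = "max_opnorm (assoc_space Y)" and ?c = "2 powr (3 * d - 1) * HL_kernel_const d"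
  have lebesgue_borel: "v \<in> borel_measurable lebesgue" if "v \<in> borel_measurable borel"
    for v :: "real \<Rightarrow> ennreal"
    using that by (simp add: measurable_completion)
  show "(\<lambda>x. ennreal (L * \<rho> x powr (- d))) \<in> borel_measurable lebesgue"
    by (rule lebesgue_borel) measurable
  have [measurable]: "(\<lambda>x. ennreal (F x)) \<in> borel_measurable lebesgue"
    by (rule lebesgue_borel) measurable
  have c: "?c \<ge> 0" using HL_kernel_const_pos[OF d] by simp
  obtain C where C: "max_bounded_const (assoc_space Y) C" "C < ?m + 1"
    using max_bounded_const_less[OF M, of "?m + 1"] by auto
  then have C0: "C \<ge> 0" by (simp add: max_bounded_const_def)
  fix h :: "real \<Rightarrow> ennreal"
  assume [measurable]: "h \<in> borel_measurable lebesgue" and h: "assoc_space Y h \<le> 1"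
  then have "assoc_space Y h < \<infinity>" by (simp add: order_le_less_trans)
  then have "assoc_space Y (HL_max h) \<le> ennreal C * assoc_space Y h"
    using C(1) by (simp add: max_bounded_const_def)
  also have "\<dots> \<le> ennreal (?m + 1) * 1"
    using C h by (intro mult_mono ennreal_leI) auto
  finally have Mh: "assoc_space Y (HL_max h) \<le> ennreal (?m + 1)" by simp
  have "(\<integral>\<^sup>+x. ennreal (L * \<rho> x powr (- d)) * h x \<partial>lebesgue)
      \<le> ennreal ?c * (\<integral>\<^sup>+u. ennreal (F u) * HL_max h u \<partial>lebesgue)"
    by (rule nn_integral_stopping_radius_le[OF F]) measurable
  also have "\<dots> \<le> ennreal ?c * (Y (\<lambda>x. ennreal (F x)) * assoc_space Y (HL_max h))"
    by (intro mult_left_mono assoc_space_Holder ball_bfs_qbfs[OF Y] fin) auto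
  also have "\<dots> \<le> ennreal ?c * (Y (\<lambda>x. ennreal (F x)) * ennreal (?m + 1))"
    by (intro mult_left_mono Mh) auto
  also have "\<dots> = ennreal (?c * (?m + 1)) * Y (\<lambda>x. ennreal (F x))"
  proof -
    have "ennreal (?c * (?m + 1)) = ennreal ?c * ennreal (?m + 1)"
      using c C C0 by (intro ennreal_mult) auto
    then show ?thesis by (simp only: mult_ac)
  qed
  finally show "(\<integral>\<^sup>+x. ennreal (L * \<rho> x powr (- d)) * h x \<partial>lebesgue)
      \<le> ennreal (?c * (?m + 1)) * Y (\<lambda>x. ennreal (F x))" .
qed

subsection \<open>Level sets of difference quotients\<close>

text \<open>The graph of the power lies above its tangent at \<open>m\<close>. For
  \<open>p > 1\<close> this is Young's inequality with exponents \<open>p\<close> and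
  \<open>p / (p - 1)\<close>; the latter degenerates at \<open>p = 1\<close>, whence the case
  split.\<close>

lemma powr_tangent_le:
  fixes a m p :: real
  assumes p: "p \<ge> 1" and "a \<ge> 0" "m \<ge> 0"
  shows "p * m powr (p - 1) * a \<le> a powr p + (p - 1) * m powr p"
proof (cases "p = 1")
  case True
  then show ?thesis using assms by (cases "m = 0") auto
next
  case False
  then have p1: "p > 1" using p by simp
  define q where "q = p / (p - 1)"
  have q: "q > 1" "1 / p + 1 / q = 1" using p1 by (auto simp: q_def field_simps)
  have "a * m powr (p - 1) \<le> a powr p / p + (m powr (p - 1)) powr q / q"
    using p1 q assms by (intro Youngs_inequality) auto
  also have "(m powr (p - 1)) powr q / q = (p - 1) * m powr p / p"
    using p1 by (simp add: q_def powr_powr)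
  finally have "p * (a * m powr (p - 1)) \<le> p * (a powr p / p + (p - 1) * m powr p / p)"
    using p1 by (intro mult_left_mono) auto
  also have "\<dots> = a powr p + (p - 1) * m powr p" using p1 by (simp add: field_simps)
  finally show ?thesis by (simp add: mult_ac)
qed

text \<open>Jensen's inequality for the mean of \<open>f'\<close>, obtained by integrating the tangent line
  inequality at the mean value.\<close>

lemma mean_increment_powr_le:
  fixes f f' \<Phi> :: "real \<Rightarrow> real"
  assumes f: "\<And>x. (f has_real_derivative f' x) (at x)"
    and \<Phi>: "\<And>x. (\<Phi> has_real_derivative \<bar>f' x\<bar> powr p) (at x)"
    and p: "p \<ge> 1" and ab: "a < b"
  shows "(\<bar>f b - f a\<bar> / (b - a)) powr p * (b - a) \<le> \<Phi> b - \<Phi> a"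
proof -
  define m where "m = \<bar>f b - f a\<bar> / (b - a)"
  have m: "m \<ge> 0" using ab by (simp add: m_def)
  define \<sigma> :: real where "\<sigma> = (if f b \<ge> f a then 1 else -1)"
  have \<sigma>: "\<sigma> * (f b - f a) = m * (b - a)"
    using ab by (simp add: \<sigma>_def m_def)
  \<comment> \<open>\<open>\<psi>\<close> is nondecreasing by the tangent inequality at
    \<open>m\<close>; the sign \<open>\<sigma>\<close> turns the increment of \<open>f\<close> into
    \<open>m * (b - a)\<close>.\<close>
  define \<psi> where "\<psi> t = \<Phi> t - p * m powr (p - 1) * (\<sigma> * f t) + (p - 1) * m powr p * t" for t
  have "\<psi> a \<le> \<psi> b"
  proof (rule DERIV_nonneg_imp_nondecreasing[where f=\<psi> and a=a and b=b])
    show "a \<le> b" using ab by simp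
    fix x
    have "(\<psi> has_real_derivative \<bar>f' x\<bar> powr p - p * m powr (p - 1) * (\<sigma> * f' x) + (p - 1) * m powr p * 1) (at x)"
      unfolding \<psi>_def by (intro DERIV_add DERIV_diff DERIV_cmult f \<Phi> DERIV_ident)
    moreover have "0 \<le> \<bar>f' x\<bar> powr p - p * m powr (p - 1) * (\<sigma> * f' x) + (p - 1) * m powr p * 1"
    proof -
      have "p * m powr (p - 1) * (\<sigma> * f' x) \<le> p * m powr (p - 1) * \<bar>f' x\<bar>"
        using p by (intro mult_left_mono) (auto simp: \<sigma>_def)
      also have "p * m powr (p - 1) * \<bar>f' x\<bar> \<le> \<bar>f' x\<bar> powr p + (p - 1) * m powr p"
        using p m by (intro powr_tangent_le) auto
      finally show ?thesis by simp
    qed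
    ultimately show "\<exists>y. (\<psi> has_real_derivative y) (at x) \<and> 0 \<le> y" by blast
  qed
  then have "p * m powr (p - 1) * (\<sigma> * (f b - f a)) \<le> \<Phi> b - \<Phi> a + (p - 1) * m powr p * (b - a)"
    by (simp add: \<psi>_def algebra_simps)
  moreover have "p * m powr (p - 1) * (m * (b - a)) = p * m powr p * (b - a)"
    using m by (cases "m = 0") (simp_all add: powr_diff)
  ultimately show ?thesis
    unfolding \<sigma> m_def[symmetric] by (simp add: algebra_simps)
qed

text \<open>The region consists of two half-lines, each contributing
  \<open>r powr \<gamma> / (- \<gamma>)\<close>. The spelling \<open>x + - 1 * y\<close> in the
  proof fits the affine change of variables.\<close>

lemma nn_integral_powr_tail:
  assumes r: "r > 0" and \<gamma>: "\<gamma> < 0"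
  shows "(\<integral>\<^sup>+y. indicator {y. r \<le> \<bar>x - y\<bar>} y * ennreal (\<bar>x - y\<bar> powr (\<gamma> - 1)) \<partial>lborel)
    \<le> ennreal (2 / (- \<gamma>) * r powr \<gamma>)"
proof -
  define g where "g y = ennreal (y powr (\<gamma> - 1)) * indicator {r..} y" for y
  have [measurable]: "g \<in> borel_measurable borel" unfolding g_def by measurable
  have g: "(\<integral>\<^sup>+y. g y \<partial>lborel) = ennreal (r powr \<gamma> / (- \<gamma>))"
    unfolding g_def using has_integral_powr_to_inf[of "\<gamma> - 1" r] assms
    by (subst nn_integral_has_integral_lebesgue') auto
  have "(\<integral>\<^sup>+y. indicator {y. r \<le> \<bar>x - y\<bar>} y * ennreal (\<bar>x - y\<bar> powr (\<gamma> - 1)) \<partial>lborel)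
      \<le> (\<integral>\<^sup>+y. g (x + - 1 * y) + g (- x + 1 * y) \<partial>lborel)"
    by (intro nn_integral_mono) (auto simp: g_def indicator_def abs_if)
  also have "\<dots> = (\<integral>\<^sup>+y. g (x + - 1 * y) \<partial>lborel) + (\<integral>\<^sup>+y. g (- x + 1 * y) \<partial>lborel)"
    by (rule nn_integral_add) auto
  also have "\<dots> = (\<integral>\<^sup>+y. g y \<partial>lborel) + (\<integral>\<^sup>+y. g y \<partial>lborel)"
    using nn_integral_real_affine[of g "- 1" x] nn_integral_real_affine[of g 1 "- x"] by simp
  also have "\<dots> = ennreal (2 / (- \<gamma>) * r powr \<gamma>)"
    unfolding g using \<gamma> by (subst ennreal_plus[symmetric]) (auto simp: divide_nonneg_neg)
  finally show ?thesis .
qed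

section \<open>Powers of extended nonnegative reals, and the mass function\<close>

lemma enn_pow_ennreal: "a \<ge> 0 \<Longrightarrow> enn_pow (ennreal a) t = ennreal (a powr t)"
  by (simp add: enn_pow_def)

lemma enn_pow_mono: "t \<ge> 0 \<Longrightarrow> a \<le> b \<Longrightarrow> enn_pow a t \<le> enn_pow b t"
  by (cases a; cases b) (auto simp: enn_pow_def top_unique intro!: ennreal_leI powr_mono2)

lemma enn_pow_measurable [measurable (raw)]:
  assumes [measurable]: "g \<in> borel_measurable M"
  shows "(\<lambda>x. enn_pow (g x) t) \<in> borel_measurable M"
  unfolding enn_pow_def by measurable

lemma enn_pow_le_imp_le:
  assumes "enn_pow X p \<le> ennreal a" "p > 0" "a \<ge> 0"
  shows "X \<le> ennreal (a powr (1 / p))"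
proof (cases X)
  case (real x)
  then have "x powr p \<le> a" using assms by (simp add: enn_pow_ennreal ennreal_le_iff)
  then have "(x powr p) powr (1 / p) \<le> a powr (1 / p)" using assms by (intro powr_mono2) auto
  then show ?thesis using real assms by (simp add: powr_powr ennreal_leI)
qed (use assms in \<open>simp add: enn_pow_def top_unique\<close>)

text \<open>Supplies the data of \<open>stopping_radius\<close>. The mass bound \<open>T\<close>
  exists because \<open>\<Phi>\<close> increases only on an interval containing the support of
  \<open>F\<close>.\<close>

lemma antiderivative_of_compactly_supported:
  fixes F :: "real \<Rightarrow> real"
  assumes F: "continuous_on UNIV F" "\<And>x. 0 \<le> F x" "bounded {x. F x \<noteq> 0}"
  obtains \<Phi> T where "\<And>x. (\<Phi> has_real_derivative F x) (at x)" "mono \<Phi>" "\<And>a b. \<Phi> b - \<Phi> a \<le> T"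
proof -
  have "\<exists>\<Phi>. \<forall>x::real. - \<infinity> < ereal x \<longrightarrow> ereal x < \<infinity> \<longrightarrow> (\<Phi> has_vector_derivative F x) (at x)"
    using F(1) by (intro einterval_antiderivative) (auto simp: continuous_on_eq_continuous_at)
  then obtain \<Phi> where \<Phi>: "\<And>x. (\<Phi> has_real_derivative F x) (at x)"
    by (auto simp: has_real_derivative_iff_has_vector_derivative)
  have mono: "mono \<Phi>"
    using \<Phi> F(2) by (intro monoI DERIV_nonneg_imp_nondecreasing[where f=\<Phi>]) auto
  obtain M where M: "\<And>x. F x \<noteq> 0 \<Longrightarrow> \<bar>x\<bar> \<le> M"
    using F(3) by (auto simp: bounded_iff)
  have mass: "\<Phi> b - \<Phi> a \<le> \<Phi> \<bar>M\<bar> - \<Phi> (- \<bar>M\<bar>)" for a b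
  proof (cases "a \<le> b")
    case True
    have [measurable]: "F \<in> borel_measurable borel"
      using F(1) by (rule borel_measurable_continuous_onI)
    have FTC: "(\<integral>\<^sup>+x. ennreal (F x) * indicator {c..e} x \<partial>lborel) = ennreal (\<Phi> e - \<Phi> c)" if "c \<le> e" for c e
      using that \<Phi> F(2) by (intro nn_integral_FTC_Icc) auto
    have "ennreal (\<Phi> b - \<Phi> a) \<le> ennreal (\<Phi> \<bar>M\<bar> - \<Phi> (- \<bar>M\<bar>))"
      unfolding FTC[OF True, symmetric] FTC[of "- \<bar>M\<bar>" "\<bar>M\<bar>", simplified, symmetric]
    proof (rule nn_integral_mono)
      fix x
      show "ennreal (F x) * indicator {a..b} x \<le> ennreal (F x) * indicator {- \<bar>M\<bar>..\<bar>M\<bar>} x"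
        using M[of x] by (cases "F x = 0") (auto simp: indicator_def abs_le_iff)
    qed
    then show ?thesis using monoD[OF mono, of "- \<bar>M\<bar>" "\<bar>M\<bar>"] by (simp add: ennreal_le_iff)
  next
    case False
    then show ?thesis using monoD[OF mono, of b a] monoD[OF mono, of "- \<bar>M\<bar>" "\<bar>M\<bar>"] by simp
  qed
  show thesis by (rule that[OF \<Phi> mono mass])
qed

text \<open>The first factor is the tail constant of the inner integral, raised to
  \<open>1 / q\<close>; the second is the norm bound in the convexified space, raised to
  \<open>1 / p\<close> on the way back to \<open>N\<close>.\<close>

definition BSVY_const :: "real \<Rightarrow> real \<Rightarrow> real \<Rightarrow> real \<Rightarrow> real" where
  "BSVY_const p q \<gamma> m = (let d = - \<gamma> * p / q in
     (2 / (- \<gamma>)) powr (1 / q) * (2 powr (3 * d - 1) * HL_kernel_const d * (m + 1)) powr (1 / p))"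

lemma
  assumes "1 \<le> p" "1 \<le> q" "q \<le> p" "\<gamma> < -1"
  shows BSVY_const_continuous: "continuous_on {0<..} (BSVY_const p q \<gamma>)"
    and BSVY_const_mono: "mono_on {0<..} (BSVY_const p q \<gamma>)"
    and BSVY_const_pos: "0 < m \<Longrightarrow> BSVY_const p q \<gamma> m > 0"
proof -
  define d where "d = - \<gamma> * p / q"
  have "1 * q < - \<gamma> * p" using assms by (intro mult_less_le_imp_less) auto
  then have d: "d > 1" using assms by (simp add: d_def field_simps)
  define c where "c = 2 powr (3 * d - 1) * HL_kernel_const d"
  have c: "c > 0" using HL_kernel_const_pos[OF d] by (simp add: c_def)
  have eq: "BSVY_const p q \<gamma> = (\<lambda>m. (2 / (- \<gamma>)) powr (1 / q) * (c * (m + 1)) powr (1 / p))"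
    by (simp add: fun_eq_iff BSVY_const_def Let_def d_def c_def)
  show "continuous_on {0<..} (BSVY_const p q \<gamma>)"
    unfolding eq using c by (intro continuous_intros) auto
  show "mono_on {0<..} (BSVY_const p q \<gamma>)"
    unfolding eq using c assms by (intro mono_onI mult_left_mono powr_mono2) auto
  show "BSVY_const p q \<gamma> m > 0" if "0 < m"
    unfolding eq using c that assms by auto
qed

section \<open>The estimate at one level and the conclusion\<close>

lemma E_set_level_integral_measurable:
  assumes "continuous_on UNIV f"
  shows "(\<lambda>x. \<integral>\<^sup>+ y. indicator (E_set lam \<beta> f) (x, y) * ennreal (\<bar>x - y\<bar> powr s) \<partial>lborel)
    \<in> borel_measurable borel"
proof -
  have [measurable]: "f \<in> borel_measurable borel"
    using assms by (rule borel_measurable_continuous_onI)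
  have ind: "indicator (E_set lam \<beta> f) (x, y) =
      (if x \<noteq> y \<and> \<bar>f x - f y\<bar> / \<bar>x - y\<bar> powr (1 + \<beta>) > lam then 1 else 0 :: ennreal)" for x y
    by (simp add: E_set_def)
  show ?thesis unfolding ind by measurable
qed

lemma level_set_norm_le:
  assumes N: "ball_bfs N" and p: "1 \<le> p" and q: "1 \<le> q" "q \<le> p" and \<gamma>: "\<gamma> < -1"
    and Y: "ball_bfs (convexify N (1 / p))" and M: "max_bounded (assoc_space (convexify N (1 / p)))"
    and f: "\<And>x. (f has_real_derivative f' x) (at x)" and f'_cont: "continuous_on UNIV f'"
    and supp: "bounded {x. f' x \<noteq> 0}" and lam: "0 < lam"
  shows "ennreal lam * N (\<lambda>x. enn_pow (\<integral>\<^sup>+ y. indicator (E_set lam (\<gamma> / q) f) (x, y) *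
            ennreal (\<bar>x - y\<bar> powr (\<gamma> - 1)) \<partial>lebesgue) (1 / q))
    \<le> ennreal (BSVY_const p q \<gamma> (max_opnorm (assoc_space (convexify N (1 / p))))) * N (\<lambda>x. ennreal \<bar>f' x\<bar>)"
    (is "ennreal lam * N (\<lambda>x. enn_pow (?G x) (1 / q)) \<le> ennreal (BSVY_const p q \<gamma> (max_opnorm (assoc_space ?Y))) * _")
proof (cases "\<forall>x. f' x = 0")
  \<comment> \<open>Without mass no radius is admissible, so this case is settled directly:
    \<open>f\<close> is constant and its level set at a positive height is empty.\<close>
  case True
  have eq: "f x = f y" for x y
    using DERIV_isconst_all[of f] f True by metis
  have diff: "f x - f y = 0" for x y
    using eq[of x y] by simp
  have "E_set lam (\<gamma> / q) f = {}" using lam by (auto simp: E_set_def diff)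
  then have "(\<lambda>x. enn_pow (?G x) (1 / q)) = (\<lambda>x. 0)"
    by (simp add: enn_pow_def)
  then show ?thesis using ball_qbfs_zero[OF ball_bfs_qbfs[OF N]] by simp
next
  case False
  note Q = ball_bfs_qbfs[OF N]
  define d where "d = - \<gamma> * p / q"
  have "1 * q < - \<gamma> * p" using p q \<gamma> by (intro mult_less_le_imp_less) auto
  then have d: "d > 1" using q by (simp add: d_def field_simps)
  define m where "m = max_opnorm (assoc_space ?Y)"
  have m: "m + 1 > 0"
  proof -
    obtain C where "max_bounded_const (assoc_space ?Y) C" "C < m + 1"
      using max_bounded_const_less[OF M, of "m + 1"] by (auto simp: m_def)
    then show ?thesis by (auto simp: max_bounded_const_def)
  qed
  define c where "c = 2 powr (3 * d - 1) * HL_kernel_const d * (m + 1)"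
  have c: "c > 0" using HL_kernel_const_pos[OF d] m by (simp add: c_def)
  define L where "L = lam powr p"
  have L: "L > 0" using lam by (simp add: L_def)
  define F where "F x = \<bar>f' x\<bar> powr p" for x
  have F_cont: "continuous_on UNIV F"
    unfolding F_def using f'_cont p by (intro continuous_intros continuous_on_powr') auto
  have F_nonneg: "0 \<le> F x" for x by (simp add: F_def)
  have "{x. F x \<noteq> 0} = {x. f' x \<noteq> 0}" by (simp add: F_def)
  then obtain \<Phi> T where \<Phi>: "\<And>x. (\<Phi> has_real_derivative F x) (at x)" "mono \<Phi>"
      "\<And>a b. \<Phi> b - \<Phi> a \<le> T"
    using antiderivative_of_compactly_supported[OF F_cont F_nonneg] supp by metis
  have nonconst: "\<exists>a b. \<Phi> a < \<Phi> b"
  proof (rule ccontr)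
    assume "\<not> ?thesis"
    then have "\<Phi> a = \<Phi> b" for a b by (meson linorder_less_linear)
    then have "\<Phi> = (\<lambda>x. \<Phi> 0)" by auto
    then have "F x = 0" for x
      using DERIV_unique[OF \<Phi>(1)[of x]] DERIV_const by metis
    with False show False by (auto simp: F_def)
  qed
  interpret stopping_radius \<Phi> L d T
  proof
    show "continuous_on UNIV \<Phi>" using \<Phi>(1) by (intro DERIV_continuous_on) (blast intro: has_field_derivative_at_within)
  qed (use \<Phi> L d nonconst in auto)
  \<comment> \<open>Jensen's inequality puts mass at least \<open>L * r powr (1 - d)\<close> between
    \<open>x\<close> and \<open>y\<close>, as \<open>\<gamma> / q * p + 1 = 1 - d\<close>. The ball
    of radius \<open>r\<close> about \<open>x\<close> contains that interval, so \<open>r\<close> is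
    admissible.\<close>
  have far: "\<rho> x \<le> \<bar>x - y\<bar>" if "(x, y) \<in> E_set lam (\<gamma> / q) f" for x y
  proof -
    define r where "r = \<bar>x - y\<bar>"
    have r: "r > 0" and gt: "\<bar>f x - f y\<bar> / r powr (1 + \<gamma> / q) > lam"
      using that by (auto simp: E_set_def r_def)
    have *: "(\<bar>f x - f y\<bar> / r) powr p * r \<le> \<Phi> (max x y) - \<Phi> (min x y)"
      using mean_increment_powr_le[OF f \<Phi>(1)[unfolded F_def] p, of "min x y" "max x y"] r
      by (auto simp: r_def min_def max_def abs_minus_commute abs_if split: if_splits)
    have "lam * r powr (\<gamma> / q) < \<bar>f x - f y\<bar> / r"
      using gt r by (simp add: powr_add field_simps)
    then have "(lam * r powr (\<gamma> / q)) powr p \<le> (\<bar>f x - f y\<bar> / r) powr p"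
      using lam p by (intro powr_mono2) auto
    then have "(lam * r powr (\<gamma> / q)) powr p * r \<le> (\<bar>f x - f y\<bar> / r) powr p * r"
      using r by (intro mult_right_mono) auto
    moreover have "(lam * r powr (\<gamma> / q)) powr p * r = L * r powr (1 - d)"
    proof -
      have "\<gamma> / q * p = - d" by (simp add: d_def)
      then show ?thesis using lam r by (simp add: powr_mult powr_powr L_def powr_diff powr_minus field_simps)
    qed
    moreover have "\<Phi> (max x y) - \<Phi> (min x y) \<le> \<Phi> (x + r) - \<Phi> (x - r)"
      by (rule diff_mono; rule monoD[OF mono]; simp add: r_def abs_if)
    ultimately show ?thesis unfolding r_def[symmetric] using r * by (intro \<rho>_le) linarith+
  qed
  have G_le: "?G x \<le> ennreal (2 / (- \<gamma>) * \<rho> x powr \<gamma>)" for x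
  proof -
    have "?G x \<le> (\<integral>\<^sup>+y. indicator {y. \<rho> x \<le> \<bar>x - y\<bar>} y * ennreal (\<bar>x - y\<bar> powr (\<gamma> - 1)) \<partial>lborel)"
      unfolding nn_integral_completion
      by (intro nn_integral_mono mult_right_mono) (auto simp: indicator_def dest: far)
    also have "\<dots> \<le> ennreal (2 / (- \<gamma>) * \<rho> x powr \<gamma>)"
      using \<gamma> by (intro nn_integral_powr_tail \<rho>_pos) auto
    finally show ?thesis .
  qed
  define K where "K = (2 / (- \<gamma>)) powr (1 / q)"
  have K: "K > 0" using \<gamma> by (simp add: K_def)
  have "continuous_on UNIV f"
    using f by (intro DERIV_continuous_on) (blast intro: has_field_derivative_at_within)
  from E_set_level_integral_measurable[OF this]
  have [measurable]: "?G \<in> borel_measurable lebesgue"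
    unfolding nn_integral_completion by (simp add: measurable_completion)
  have [measurable]: "\<rho> \<in> borel_measurable lebesgue"
    using \<rho>_measurable by (simp add: measurable_completion)
  define v where "v x = ennreal (\<rho> x powr (\<gamma> / q))" for x
  have [measurable]: "v \<in> borel_measurable lebesgue" unfolding v_def by measurable
  have pow_G: "enn_pow (?G x) (1 / q) \<le> ennreal K * v x" for x
  proof -
    have "enn_pow (?G x) (1 / q) \<le> enn_pow (ennreal (2 / (- \<gamma>) * \<rho> x powr \<gamma>)) (1 / q)"
      using q by (intro enn_pow_mono G_le) auto
    also have "\<dots> = ennreal K * v x"
    proof -
      have "0 \<le> 2 / (- \<gamma>) * \<rho> x powr \<gamma>" using \<gamma> by (intro mult_nonneg_nonneg) auto
      moreover have "(2 / (- \<gamma>) * \<rho> x powr \<gamma>) powr (1 / q) = K * \<rho> x powr (\<gamma> / q)"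
        unfolding K_def using \<gamma> by (subst powr_mult) (auto simp: powr_powr)
      ultimately show ?thesis using K by (simp add: enn_pow_ennreal v_def ennreal_mult del: times_divide_eq_left)
    qed
    finally show ?thesis .
  qed
  have N_pow: "N (\<lambda>x. enn_pow (?G x) (1 / q)) \<le> ennreal K * N v"
  proof -
    have "N (\<lambda>x. enn_pow (?G x) (1 / q)) \<le> N (\<lambda>x. ennreal K * v x)"
      by (rule ball_qbfs_mono[OF Q]) (use pow_G in auto)
    also have "\<dots> = ennreal K * N v" using K by (intro ball_qbfs_scale[OF Q]) auto
    finally show ?thesis .
  qed
  \<comment> \<open>The power \<open>1 / p\<close> undoes \<open>L = lam powr p\<close> and turns
    \<open>- d\<close> into \<open>\<gamma> / q\<close>, the exponent left by the inner
    integral.\<close>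
  have lam_v: "ennreal lam * N v = N (\<lambda>x. enn_pow (ennreal (L * \<rho> x powr (- d))) (1 / p))"
  proof -
    have "enn_pow (ennreal (L * \<rho> x powr (- d))) (1 / p) = ennreal lam * v x" for x
    proof -
      have "- d / p = \<gamma> / q" using p by (simp add: d_def)
      then have "(L * \<rho> x powr (- d)) powr (1 / p) = lam * \<rho> x powr (\<gamma> / q)"
        using p lam by (simp add: powr_mult powr_powr L_def)
      moreover have "0 \<le> L * \<rho> x powr (- d)" using L by simp
      ultimately have "enn_pow (ennreal (L * \<rho> x powr (- d))) (1 / p) = ennreal (lam * \<rho> x powr (\<gamma> / q))"
        by (simp only: enn_pow_ennreal)
      then show ?thesis using lam by (simp add: v_def ennreal_mult)
    qed
    then show ?thesis using lam by (simp add: ball_qbfs_scale[OF Q])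
  qed
  have [measurable]: "f' \<in> borel_measurable borel"
    using f'_cont by (rule borel_measurable_continuous_onI)
  have [measurable]: "f' \<in> borel_measurable lebesgue"
    using \<open>f' \<in> borel_measurable borel\<close> by (simp add: measurable_completion)
  \<comment> \<open>The Hoelder inequality asks for finiteness; it holds as \<open>f'\<close> is
    bounded with bounded support and \<open>N\<close> is finite on indicators of intervals.\<close>
  have fin: "N (\<lambda>x. ennreal \<bar>f' x\<bar>) < \<infinity>"
  proof -
    obtain R where R: "\<And>x. f' x \<noteq> 0 \<Longrightarrow> \<bar>x\<bar> \<le> R" using supp by (auto simp: bounded_iff)
    have "compact (f' ` {- R..R})"
      by (intro compact_continuous_image continuous_on_subset[OF f'_cont]) auto
    then have "bounded (f' ` {- R..R})" by (rule compact_imp_bounded)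
    then obtain B where "\<forall>y \<in> f' ` {- R..R}. \<bar>y\<bar> \<le> B"
      unfolding bounded_iff real_norm_def by blast
    then have B: "\<bar>f' x\<bar> \<le> B" if "x \<in> {- R..R}" for x
      using that by blast
    have "ennreal \<bar>f' x\<bar> \<le> ennreal \<bar>B\<bar> * indicator {- R..R} x" for x
    proof (cases "x \<in> {- R..R}")
      case True
      have "\<bar>f' x\<bar> \<le> \<bar>B\<bar>" using B[OF True] by simp
      then show ?thesis using True by (simp add: ennreal_leI)
    next
      case False
      then have "\<not> \<bar>x\<bar> \<le> R" by auto
      then have "f' x = 0" using R[of x] by blast
      then show ?thesis by simp
    qed
    then have "N (\<lambda>x. ennreal \<bar>f' x\<bar>) \<le> N (\<lambda>x. ennreal \<bar>B\<bar> * indicator {- R..R} x)"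
      by (intro ball_qbfs_mono[OF Q]) auto
    also have "\<dots> = ennreal \<bar>B\<bar> * N (indicator {- R..R})"
      by (intro ball_qbfs_scale[OF Q]) auto
    also have "\<dots> < \<infinity>"
      using ball_qbfs_indicator[OF Q] by (simp add: ennreal_mult_less_top)
    finally show ?thesis .
  qed
  then obtain b where b: "N (\<lambda>x. ennreal \<bar>f' x\<bar>) = ennreal b" "b \<ge> 0"
    by (cases "N (\<lambda>x. ennreal \<bar>f' x\<bar>)") auto
  have "enn_pow (ennreal (F x)) (1 / p) = ennreal \<bar>f' x\<bar>" for x
    using p by (simp add: enn_pow_ennreal F_def powr_powr)
  then have YF: "?Y (\<lambda>x. ennreal (F x)) = ennreal (b powr p)"
    using b by (simp add: convexify_def enn_pow_ennreal)
  have [measurable]: "F \<in> borel_measurable borel" unfolding F_def by measurable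
  have "?Y (\<lambda>x. ennreal (L * \<rho> x powr (- d))) \<le> ennreal c * ?Y (\<lambda>x. ennreal (F x))"
    unfolding c_def m_def by (intro norm_stopping_radius_le Y M \<Phi> F_nonneg) (simp_all add: YF)
  \<comment> \<open>Convexification with exponent \<open>1 / p\<close> carries an outer power
    \<open>p\<close>, which the next step removes.\<close>
  then have "enn_pow (ennreal lam * N v) p \<le> ennreal (c * b powr p)"
    unfolding YF lam_v using c by (simp add: convexify_def ennreal_mult)
  then have "ennreal lam * N v \<le> ennreal ((c * b powr p) powr (1 / p))"
    using p c by (intro enn_pow_le_imp_le) auto
  also have "(c * b powr p) powr (1 / p) = c powr (1 / p) * b"
    using p b c by (simp add: powr_mult powr_powr)
  finally have v_le: "ennreal lam * N v \<le> ennreal (c powr (1 / p) * b)" .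
  have "ennreal lam * N (\<lambda>x. enn_pow (?G x) (1 / q)) \<le> ennreal lam * (ennreal K * N v)"
    by (intro mult_left_mono N_pow) auto
  also have "\<dots> = ennreal K * (ennreal lam * N v)" by (simp add: mult_ac)
  also have "\<dots> \<le> ennreal K * ennreal (c powr (1 / p) * b)" by (intro mult_left_mono v_le) auto
  also have "\<dots> = ennreal (K * c powr (1 / p)) * ennreal b"
    using K b by (simp add: ennreal_mult mult.assoc)
  also have "K * c powr (1 / p) = BSVY_const p q \<gamma> m"
    by (simp add: BSVY_const_def Let_def K_def c_def d_def)
  finally show ?thesis unfolding b(1) m_def .
qed

text \<open>The constant at one level is free of \<open>lam\<close>, so the supremum is immediate.
  Fixing \<open>Cf\<close> before \<open>N\<close> lets the space enter only through the operator
  norm.\<close>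

theorem theorem3p14:
  "\<exists>Cf :: real \<Rightarrow> real \<Rightarrow> real \<Rightarrow> real \<Rightarrow> real.
     (\<forall>p q \<gamma>. 1 \<le> p \<longrightarrow> 1 \<le> q \<longrightarrow> q \<le> p \<longrightarrow> \<gamma> < -1 \<longrightarrow>
        continuous_on {0<..} (Cf p q \<gamma>) \<and> mono_on {0<..} (Cf p q \<gamma>) \<and>
        (\<forall>m>0. Cf p q \<gamma> m > 0)) \<and>
     (\<forall>(N::fnorm) p q \<gamma>. ball_bfs N \<longrightarrow> 1 \<le> p \<longrightarrow> 1 \<le> q \<longrightarrow> q \<le> p \<longrightarrow> \<gamma> < -1 \<longrightarrow>
        ball_bfs (convexify N (1 / p)) \<longrightarrow>
        max_bounded (assoc_space (convexify N (1 / p))) \<longrightarrow>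
        (\<forall>f f' :: real \<Rightarrow> real.
           (\<forall>x. (f has_real_derivative f' x) (at x)) \<longrightarrow> continuous_on UNIV f' \<longrightarrow>
           bounded {x. f' x \<noteq> 0} \<longrightarrow>
           (SUP lam\<in>{0<..}. ennreal lam *
              N (\<lambda>x. enn_pow (\<integral>\<^sup>+ y. indicator (E_set lam (\<gamma> / q) f) (x, y) *
                                     ennreal (\<bar>x - y\<bar> powr (\<gamma> - 1)) \<partial>lebesgue) (1 / q)))
           \<le> ennreal (Cf p q \<gamma> (max_opnorm (assoc_space (convexify N (1 / p))))) *
              N (\<lambda>x. ennreal \<bar>f' x\<bar>)))"
  by (intro exI[of _ BSVY_const] conjI allI impI BSVY_const_continuous BSVY_const_mono BSVY_const_pos
      SUP_least level_set_norm_le) auto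

end
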